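(* Let $C\in\mathbb D$. Then: (1) Both $R_{\bar K_C,L_0}$ and $R_{\bar K_C^\flat,L_0}$ contain non-constant polynomials; in fact $R_{\bar K_C,L_0}=\{p\in\mathbb C[z]: p'(\lambda_i)=0,\ i=1,\dots,n\}$. (2) The set $\mathcal R_C:=\{K_C\,p(L_0)\,K_C^{-1}: p\in R_{\bar K_C,L_0}\}$ is a commutative ring of ordinary differential operators which is bispectral in the following sense: let $f$ be a nonzero element of $\ker L_0$, let $a^\flat(z)$ be the leading coefficient of $\bar K_C^\flat(z,\partial_z)$, and put $\phi(x,z)=\frac{1}{\tau_C(x)a^\flat(z)}\bar K_C(\hat f(x,z))$. Then for every $p\in R_{\bar K_C,L_0}$, $K_C p(L_0)K_C^{-1}\phi=p(z)\phi$, and for every $p\in R_{\bar K_C^\flat,L_0}$ the operator $P(z,\partial_z)=\tilde K^\flat\,p(L_0(z,\partial_z))\,(\tilde K^\flat)^{-1}$, where $\tilde K^\flat=\frac1{a^\flat(z)}\bar K_C^\flat(z,\partial_z)$, is a differential operator in $z$ satisfying $P(z,\partial_z)\phi=p(x)\phi$; and $R_{\bar K_C^\flat,L_0}$ contains non-constant polynomials.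
   Context: Fix an integer $r>1$ and constants $a_1,\dots,a_{r-2}\in\mathbb C$, and let $L_0=\partial^r-a_{r-2}\partial^{r-2}-\cdots-a_1\partial-x$, where $\partial=d/dx$. Fix a basis $f_1,\dots,f_r$ of $\ker L_0$ normalized so that the Wronskian determinant $|Wr(f_1,\dots,f_r)|=1$. For a function $f$ of one variable write $\hat f(x,z)=f(x+z)$. $\mathcal S$ denotes the space of finitely supported distributions in the $z$-plane: finite linear combinations of $\delta_\lambda\circ\partial_z^j$ ($\lambda\in\mathbb C$, $j\ge0$), where $\delta_\lambda$ evaluates its argument at $z=\lambda$; applied to a function $\psi(x,z)$ such a distribution acts in the $z$ variable and yields a function of $x$. $\mathbb D$ is the set of finite-dimensional subspaces $C\subset\mathcal S$ having a basis $c_i=\delta_{\lambda_i}\circ(\partial_z+\gamma_i)$, $i=1,\dots,n$ ($n\ge1$), with $\lambda_1,\dots,\lambda_n$ pairwise distinct and $\gamma_i\in\mathbb C$. For $C\in\mathbb D$ put $N=rn$ and let $\phi_1,\dots,\phi_N$ be the functions $c_i(\hat f_j)$ ($1\le i\le n$, $1\le j\le r$). $\bar K_C$ is the operator $u\mapsto\kappa\,|Wr(\phi_1,\dots,\phi_N,u)|$, where $\kappa$ is the nonzero constant for which the coefficient of $\partial^N$ is a monic polynomial (this coefficient is a polynomial of degree $n$); $\tau_C(x)$ denotes this leading coefficient and $K_C=\tau_C^{-1}\bar K_C$ (monic, with kernel spanned by $\phi_1,\dots,\phi_N$). Here $Wr(v_1,\dots,v_m)$ is the $m\times m$ matrix whose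 first row is $(v_1,\dots,v_m)$ and each subsequent row is the derivative of the previous one, and $|\cdot|$ is the determinant. The Weyl algebra is $\mathbb C[x]\langle\partial\rangle$; $\flat$ is the unique $\mathbb C$-linear anti-automorphism of the Weyl algebra with $x^\flat=L_0$, $\partial^\flat=\partial$; equivalently $T(x,\partial_x)\hat f(x,z)=T^\flat(z,\partial_z)\hat f(x,z)$ for all $f\in\ker L_0$, where $T(z,\partial_z)$ denotes $T$ with $x$ replaced by $z$. $\mathcal D$ is the ring of ordinary differential operators in $x$ with coefficients in $\mathbb C(x)$, and for operators $T,L$, $R_{T,L}:=\{p\in\mathbb C[z]: T\,p(L)\in\mathcal D\,T\}$. *)

theory Defs
  imports "HOL-Analysis.Analysis"
    "HOL-Computational_Algebra.Polynomial_Factorial"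
    "HOL-Computational_Algebra.Normalized_Fraction"
    "HOL-Computational_Algebra.Field_as_Ring"
begin

text \<open>A differential operator sum_i c_i(x) d^i is encoded as a polynomial whose
  i-th coefficient is c_i (the polynomial structure is only used as a normalised
  finite coefficient list together with its additive structure; composition is
  the operator product dmult below, given by the Leibniz rule for a derivation d
  on the coefficient ring).\<close>

definition dmult :: "('a::comm_ring_1 \<Rightarrow> 'a) \<Rightarrow> 'a poly \<Rightarrow> 'a poly \<Rightarrow> 'a poly" where
  "dmult d A B =
     (\<Sum>i\<le>degree A. \<Sum>j\<le>degree B. \<Sum>k\<le>i.
        monom (of_nat (i choose k) * coeff A i * (d ^^ k) (coeff B j)) (i + j - k))"

fun dpow :: "('a::comm_ring_1 \<Rightarrow> 'a) \<Rightarrow> 'a poly \<Rightarrow> nat \<Rightarrow> 'a poly" where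
  "dpow d L 0 = 1"
| "dpow d L (Suc k) = dmult d L (dpow d L k)"

type_synonym weyl = "complex poly poly"

definition wmult :: "weyl \<Rightarrow> weyl \<Rightarrow> weyl" where
  "wmult = dmult pderiv"

definition weval :: "weyl \<Rightarrow> complex poly \<Rightarrow> weyl" where
  "weval L p = (\<Sum>k\<le>degree p. smult [:coeff p k:] (dpow pderiv L k))"

definition L0 :: "nat \<Rightarrow> (nat \<Rightarrow> complex) \<Rightarrow> weyl" where
  "L0 r a = monom 1 r - (\<Sum>k\<in>{1..r-2}. monom [:a k:] k) - [:[:0, 1:]:]"

text \<open>The anti-automorphism flat with x |-> L0, d |-> d:
  (sum_i p_i(x) d^i)^flat = sum_i d^i p_i(L0).\<close>
definition wflat :: "nat \<Rightarrow> (nat \<Rightarrow> complex) \<Rightarrow> weyl \<Rightarrow> weyl" where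
  "wflat r a T = (\<Sum>i\<le>degree T. wmult (monom 1 i) (weval (L0 r a) (coeff T i)))"

definition weyl_apply :: "weyl \<Rightarrow> (complex \<Rightarrow> complex) \<Rightarrow> complex \<Rightarrow> complex" where
  "weyl_apply T u x = (\<Sum>i\<le>degree T. poly (coeff T i) x * (deriv ^^ i) u x)"

type_synonym ratfun = "complex poly fract"
type_synonym dop = "ratfun poly"

definition rderiv :: "ratfun \<Rightarrow> ratfun" where
  "rderiv q = (case quot_of_fract q of (a, b) \<Rightarrow>
      Fract (pderiv a * b - a * pderiv b) (b * b))"

definition rdefined :: "ratfun \<Rightarrow> complex \<Rightarrow> bool" where
  "rdefined q x = (poly (snd (quot_of_fract q)) x \<noteq> 0)"

definition reval :: "ratfun \<Rightarrow> complex \<Rightarrow> complex" where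
  "reval q x = (case quot_of_fract q of (a, b) \<Rightarrow> poly a x / poly b x)"

definition Dmult :: "dop \<Rightarrow> dop \<Rightarrow> dop" where
  "Dmult = dmult rderiv"

definition embed :: "weyl \<Rightarrow> dop" where
  "embed T = map_poly (\<lambda>q. Fract q 1) T"

definition D_apply :: "dop \<Rightarrow> (complex \<Rightarrow> complex) \<Rightarrow> complex \<Rightarrow> complex" where
  "D_apply Q u x = (\<Sum>i\<le>degree Q. reval (coeff Q i) x * (deriv ^^ i) u x)"

definition D_defined_at :: "dop \<Rightarrow> complex \<Rightarrow> bool" where
  "D_defined_at Q x = (\<forall>i. rdefined (coeff Q i) x)"

definition Rset :: "weyl \<Rightarrow> weyl \<Rightarrow> complex poly set" where
  "Rset T L = {p. \<exists>Q::dop. embed (wmult T (weval L p)) = Dmult Q (embed T)}"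

definition conjD :: "dop \<Rightarrow> dop \<Rightarrow> dop" where
  "conjD T S = (THE Q. Dmult Q T = Dmult T S)"

definition wr_det :: "(complex \<Rightarrow> complex) list \<Rightarrow> complex \<Rightarrow> complex" where
  "wr_det vs x = (let m = length vs in
     \<Sum>\<sigma>\<in>{\<sigma>. \<sigma> permutes {..<m}}. of_int (sign \<sigma>) *
        (\<Prod>i<m. (deriv ^^ i) (vs ! (\<sigma> i)) x))"

definition in_ker :: "weyl \<Rightarrow> (complex \<Rightarrow> complex) \<Rightarrow> bool" where
  "in_ker L u \<longleftrightarrow> u holomorphic_on UNIV \<and> (\<forall>x. weyl_apply L u x = 0)"

text \<open>phi_1..phi_N: the functions c_i(hat f_j)(x) = f_j'(x+lambda_i) + gamma_i f_j(x+lambda_i)\<close>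
definition phis :: "nat \<Rightarrow> (nat \<Rightarrow> complex \<Rightarrow> complex) \<Rightarrow> nat \<Rightarrow> (nat \<Rightarrow> complex)
    \<Rightarrow> (nat \<Rightarrow> complex) \<Rightarrow> (complex \<Rightarrow> complex) list" where
  "phis r f n lam gam = concat (map (\<lambda>i. map (\<lambda>j. \<lambda>x.
       deriv (f j) (x + lam i) + gam i * f j (x + lam i)) [0..<r]) [0..<n])"

definition Kbar :: "nat \<Rightarrow> (nat \<Rightarrow> complex \<Rightarrow> complex) \<Rightarrow> nat \<Rightarrow> (nat \<Rightarrow> complex)
    \<Rightarrow> (nat \<Rightarrow> complex) \<Rightarrow> weyl" where
  "Kbar r f n lam gam = (SOME W. degree W = r * n \<and> lead_coeff (lead_coeff W) = 1 \<and>
      (\<exists>\<kappa>. \<kappa> \<noteq> 0 \<and> (\<forall>u. u holomorphic_on UNIV \<longrightarrow>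
          (\<forall>x. weyl_apply W u x = \<kappa> * wr_det (phis r f n lam gam @ [u]) x))))"

end

(* The functions f_j(x + lam_i) and phi_ij are generalized eigenfunctions of L0 with eigenvalue
   lam_i and hence linearly independent (polynomials in L0 separate the eigenvalues), so that no
   operator of order below N kills all phi_ij. Writing derivatives of the phi_ij through the
   matrices Wr(f)(x + lam_i), which have determinant 1, the Wronskian |Wr(phi, u)| becomes an
   operator in u with polynomial coefficients. An operator is a left multiple of K over C(x) iff it
   kills the phi_ij; applied to K p(L0) this gives R_{K,L0}. The bispectral equations follow from
   p(L0) acting on f(x + z) as p(z) and from the exchange of x and z by flat. *)

theory Submission
  imports "HOL-Complex_Analysis.Complex_Analysis" "Jordan_Normal_Form.Determinant" Defs
begin

hide_const (open) Module.smult

text \<open>Of the independent family, the phi_ij bound orders from below by N, while the f_j(x +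
  lam_i) serve the converse inclusion in the description of R_{K,L0}: on phi_ij the operator p(L0)
  gives p(lam_i) phi_ij + p'(lam_i) f_j(x + lam_i), so a p in R_{K,L0} with p'(lam_i) nonzero would
  make a multiple s(x) K of order N annihilate N + 1 independent functions. The obstacle is K^flat:
  its kernel is not described by explicit functions, and flat is defined only on the Weyl algebra,
  whereas the left cofactors have coefficients in C(x). Denominators are therefore cleared
  throughout: pseudo-division stands in for division, and Ore multiples with polynomial coefficients
  stand in for inverses. If P has double zeros at all lam_i, then K is a right factor of P(L0) over
  C(x); flat turns this into a right factor K^flat of theta(L0), theta being a power of the
  denominator. Independence is over the constants while leading coefficients are polynomials with
  zeros, so orders are compared through initial data at a point where the leading coefficient does
  not vanish.\<close>

lemma smult_sum_right: "smult c (sum F S) = (\<Sum>s\<in>S. smult c (F s))"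
  by (induction S rule: infinite_finite_induct) (simp_all add: smult_add_right)

section \<open>Differential operators over a commutative ring with a derivation\<close>

locale derivation =
  fixes d :: "'a::comm_ring_1 \<Rightarrow> 'a"
  assumes d_add: "d (a + b) = d a + d b"
    and d_mult: "d (a * b) = d a * b + a * d b"
begin

lemma d_0 [simp]: "d 0 = 0"
  using d_add[of 0 0] by simp

lemma d_1 [simp]: "d 1 = 0"
  using d_mult[of 1 1] by simp

text \<open>\<open>dd B\<close> is the composite of \<open>\<partial>\<close> with \<open>B\<close>. Then \<open>A B = \<Sum>\<^sub>i A\<^sub>i dd\<^sup>i B\<close>, which makes associativity
  immediate without manipulating Leibniz sums.\<close>
definition dd :: "'a poly \<Rightarrow> 'a poly" where
  "dd B = map_poly d B + pCons 0 B"

lemma coeff_dd: "coeff (dd B) k = d (coeff B k) + (case k of 0 \<Rightarrow> 0 | Suc j \<Rightarrow> coeff B j)"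
  by (simp add: dd_def coeff_map_poly coeff_pCons)

lemma dd_0 [simp]: "dd 0 = 0"
  by (simp add: dd_def)

lemma dd_add: "dd (A + B) = dd A + dd B"
  by (rule poly_eqI) (simp add: coeff_dd d_add split: nat.split)

lemma dd_smult: "dd (smult c B) = smult (d c) B + smult c (dd B)"
  by (rule poly_eqI) (simp add: coeff_dd d_mult algebra_simps split: nat.split)

lemma dd_sum: "dd (sum F S) = (\<Sum>s\<in>S. dd (F s))"
  by (induction S rule: infinite_finite_induct) (simp_all add: dd_add)

lemma ddpow_add: "(dd ^^ i) (A + B) = (dd ^^ i) A + (dd ^^ i) B"
  by (induction i) (simp_all add: dd_add)

lemma ddpow_0 [simp]: "(dd ^^ i) 0 = 0"
  by (induction i) simp_all

lemma ddpow_sum: "(dd ^^ i) (sum F S) = (\<Sum>s\<in>S. (dd ^^ i) (F s))"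
  by (induction S rule: infinite_finite_induct) (simp_all add: ddpow_add)

lemma dd_monom: "dd (monom c j) = monom (d c) j + monom c (Suc j)"
  by (rule poly_eqI) (auto simp: coeff_dd split: nat.split)

text \<open>Pascal's rule identifies the iterated composite with the inner Leibniz sum of
  \<open>dmult\<close>; binomial coefficients are handled only here.\<close>

lemma ddpow_monom:
  "(dd ^^ i) (monom c j) = (\<Sum>k\<le>i. monom (of_nat (i choose k) * (d ^^ k) c) (i + j - k))"
proof (induction i)
  case 0
  show ?case by simp
next
  case (Suc i)
  have d_nat: "d (of_nat m * b) = of_nat m * d b" for m b
    by (induction m) (simp_all add: d_add algebra_simps)
  let ?t = "\<lambda>i k. monom (of_nat (i choose k) * (d ^^ k) c)"
  have "(dd ^^ Suc i) (monom c j)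
      = (\<Sum>k\<le>i. monom (of_nat (i choose k) * (d ^^ Suc k) c) (Suc i + j - Suc k)
              + monom (of_nat (i choose k) * (d ^^ k) c) (Suc i + j - k))"
    by (auto simp: Suc dd_sum dd_monom d_nat intro!: sum.cong) (simp add: Suc_diff_le)
  also have "\<dots> = (\<Sum>k\<le>i. monom (of_nat (i choose k) * (d ^^ Suc k) c) (Suc i + j - Suc k))
              + (\<Sum>k\<le>i. monom (of_nat (i choose k) * (d ^^ k) c) (Suc i + j - k))"
    by (simp add: sum.distrib)
  also have "(\<Sum>k\<le>i. monom (of_nat (i choose k) * (d ^^ k) c) (Suc i + j - k))
      = (\<Sum>k\<le>Suc i. monom (of_nat (i choose k) * (d ^^ k) c) (Suc i + j - k))"
    by (simp add: binomial_eq_0)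
  also have "\<dots> = monom c (Suc i + j)
      + (\<Sum>k\<le>i. monom (of_nat (i choose Suc k) * (d ^^ Suc k) c) (Suc i + j - Suc k))"
    by (subst sum.atMost_Suc_shift) simp
  also have "(\<Sum>k\<le>i. monom (of_nat (i choose k) * (d ^^ Suc k) c) (Suc i + j - Suc k)) + \<dots>
      = (\<Sum>k\<le>Suc i. monom (of_nat (Suc i choose k) * (d ^^ k) c) (Suc i + j - k))"
    by (subst sum.atMost_Suc_shift)
       (simp add: ring_distribs add_monom[symmetric] sum.distrib del: sum.atMost_Suc)
  finally show ?case .
qed

abbreviation dm (infixl "\<star>" 70) where "A \<star> B \<equiv> dmult d A B"

lemma dmult_dd: "A \<star> B = (\<Sum>i\<le>degree A. smult (coeff A i) ((dd ^^ i) B))"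
proof -
  have "A \<star> B = (\<Sum>i\<le>degree A. \<Sum>j\<le>degree B. smult (coeff A i) ((dd ^^ i) (monom (coeff B j) j)))"
    unfolding dmult_def
    by (intro sum.cong refl) (simp add: ddpow_monom smult_sum_right smult_monom ac_simps)
  also have "\<dots> = (\<Sum>i\<le>degree A. smult (coeff A i) ((dd ^^ i) (\<Sum>j\<le>degree B. monom (coeff B j) j)))"
    by (simp add: ddpow_sum smult_sum_right)
  finally show ?thesis
    by (simp add: poly_as_sum_of_monoms)
qed

lemma dmult_dd_bound: "degree A \<le> m \<Longrightarrow> A \<star> B = (\<Sum>i\<le>m. smult (coeff A i) ((dd ^^ i) B))"
  unfolding dmult_dd by (intro sum.mono_neutral_left) (auto simp: coeff_eq_0)

lemma dmult_add_left: "(A + B) \<star> C = A \<star> C + B \<star> C"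
  by (subst (1 2 3) dmult_dd_bound[where m = "max (degree A) (degree B)"])
     (auto simp: degree_add_le smult_add_left sum.distrib)

lemma dmult_add_right: "A \<star> (B + C) = A \<star> B + A \<star> C"
  by (simp add: dmult_dd ddpow_add smult_add_right sum.distrib)

lemma dmult_0_left [simp]: "0 \<star> B = 0"
  by (simp add: dmult_dd)

lemma dmult_0_right [simp]: "A \<star> 0 = 0"
  by (simp add: dmult_dd)

lemma dmult_minus_left: "(- A) \<star> B = - (A \<star> B)"
  using dmult_add_left[of "-A" A B] by (simp add: eq_neg_iff_add_eq_0)

lemma dmult_minus_right: "A \<star> (- B) = - (A \<star> B)"
  using dmult_add_right[of A "-B" B] by (simp add: eq_neg_iff_add_eq_0)

lemma dmult_diff_left: "(A - B) \<star> C = A \<star> C - B \<star> C"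
  using dmult_add_left[of A "-B" C] by (simp add: dmult_minus_left)

lemma dmult_diff_right: "A \<star> (B - C) = A \<star> B - A \<star> C"
  using dmult_add_right[of A B "-C"] by (simp add: dmult_minus_right)

lemma dmult_sum_left: "(sum F S) \<star> B = (\<Sum>s\<in>S. F s \<star> B)"
  by (induction S rule: infinite_finite_induct) (simp_all add: dmult_add_left)

lemma dmult_sum_right: "B \<star> (sum F S) = (\<Sum>s\<in>S. B \<star> F s)"
  by (induction S rule: infinite_finite_induct) (simp_all add: dmult_add_right)

lemma dmult_smult_left: "smult c A \<star> B = smult c (A \<star> B)"
  by (subst (1 2) dmult_dd_bound[where m = "degree A"]) (simp_all add: smult_sum_right degree_smult_le)

lemma dmult_const_left: "[:c:] \<star> B = smult c B"
  by (simp add: dmult_dd)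

lemma dmult_1_left [simp]: "1 \<star> B = B"
  by (simp add: dmult_dd)

lemma ddpow_1: "(dd ^^ i) 1 = monom 1 i"
  by (induction i) (simp_all add: dd_monom flip: one_pCons monom_0)

lemma dmult_1_right [simp]: "A \<star> 1 = A"
  by (simp add: dmult_dd ddpow_1 smult_monom poly_as_sum_of_monoms)

text \<open>Associativity when the leftmost factor is \<partial>. The two parts of
  \<open>dd A\<close> match the two terms of \<open>dd_smult\<close>; iteration and linearity in the
  coefficients then give \<open>dmult_assoc\<close>.\<close>

lemma dmult_dd_left: "dd A \<star> B = dd (A \<star> B)"
proof -
  have deg: "degree (dd A) \<le> Suc (degree A)"
    by (rule degree_le) (auto simp: coeff_dd coeff_eq_0 split: nat.split)
  have "dd A \<star> B = (\<Sum>i\<le>Suc (degree A). smult (d (coeff A i)) ((dd ^^ i) B))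
      + (\<Sum>i\<le>Suc (degree A). smult (case i of 0 \<Rightarrow> 0 | Suc j \<Rightarrow> coeff A j) ((dd ^^ i) B))"
    by (simp only: dmult_dd_bound[OF deg] coeff_dd smult_add_left sum.distrib)
  also have "(\<Sum>i\<le>Suc (degree A). smult (d (coeff A i)) ((dd ^^ i) B))
      = (\<Sum>i\<le>degree A. smult (d (coeff A i)) ((dd ^^ i) B))"
    by (simp add: coeff_eq_0)
  also have "(\<Sum>i\<le>Suc (degree A). smult (case i of 0 \<Rightarrow> 0 | Suc j \<Rightarrow> coeff A j) ((dd ^^ i) B))
      = (\<Sum>i\<le>degree A. smult (coeff A i) (dd ((dd ^^ i) B)))"
    by (subst sum.atMost_Suc_shift) simp
  finally show ?thesis
    by (simp add: dmult_dd dd_sum dd_smult sum.distrib)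
qed

lemma dmult_ddpow_left: "(dd ^^ i) A \<star> B = (dd ^^ i) (A \<star> B)"
  by (induction i) (simp_all add: dmult_dd_left)

lemma dmult_assoc: "(A \<star> B) \<star> C = A \<star> (B \<star> C)"
  by (simp add: dmult_dd[of A B] dmult_dd[of A "B \<star> C"] dmult_sum_left dmult_smult_left dmult_ddpow_left)

lemma dmult_monom1: "monom 1 i \<star> B = (dd ^^ i) B"
proof -
  have "monom 1 i = (dd ^^ i) 1" by (simp add: ddpow_1)
  then show ?thesis by (simp add: dmult_ddpow_left)
qed

lemma dmult_monom_monom1: "monom c i \<star> monom 1 j = monom c (i + j)"
proof -
  have "monom c i \<star> monom 1 j = smult c (monom 1 i \<star> monom 1 j)"
    by (simp add: smult_monom flip: dmult_smult_left)
  also have "monom 1 i \<star> monom (1::'a) j = (dd ^^ (i + j)) 1"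
    by (simp add: dmult_monom1 funpow_add ddpow_1[of j, symmetric])
  finally show ?thesis by (simp add: ddpow_1 smult_monom)
qed

lemma degree_ddpow_le: "degree ((dd ^^ i) B) \<le> degree B + i"
proof (induction i)
  case (Suc i)
  have "degree (dd C) \<le> Suc (degree C)" for C
    by (rule degree_le) (auto simp: coeff_dd coeff_eq_0 split: nat.split)
  from le_trans[OF this Suc_le_mono[THEN iffD2, OF Suc]] show ?case by simp
qed simp

lemma coeff_ddpow_top: "coeff ((dd ^^ i) B) (degree B + i) = lead_coeff B"
proof (induction i)
  case (Suc i)
  have "coeff ((dd ^^ i) B) (Suc (degree B + i)) = 0"
    using degree_ddpow_le[of i B] by (intro coeff_eq_0) simp
  with Suc show ?case by (simp add: coeff_dd)
qed simp

lemma dmult_degree_le: "degree (A \<star> B) \<le> degree A + degree B"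
proof -
  have "degree (smult (coeff A i) ((dd ^^ i) B)) \<le> degree A + degree B" if "i \<le> degree A" for i
    using degree_ddpow_le[of i B] that degree_smult_le[of "coeff A i" "(dd ^^ i) B"] by linarith
  then show ?thesis
    unfolding dmult_dd by (intro degree_sum_le) auto
qed

lemma coeff_dmult_top: "coeff (A \<star> B) (degree A + degree B) = lead_coeff A * lead_coeff B"
proof -
  \<comment> \<open>Each \<partial> raises the order by at most one, so only the top coefficient of
    \<open>A\<close> reaches this order.\<close>
  have "coeff ((dd ^^ i) B) (degree A + degree B) = 0" if "i < degree A" for i
    using degree_ddpow_le[of i B] that by (intro coeff_eq_0) simp
  then have "coeff (A \<star> B) (degree A + degree B)
      = (\<Sum>i\<le>degree A. if i = degree A then lead_coeff A * lead_coeff B else 0)"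
    unfolding dmult_dd coeff_sum
    using coeff_ddpow_top[of "degree A" B] by (intro sum.cong) (auto simp: add.commute)
  then show ?thesis by simp
qed

lemma dmult_const_const: "[:a:] \<star> [:b:] = [:a * b:]"
  by (simp add: dmult_const_left)

end

locale domain_derivation = derivation d for d :: "'a::idom \<Rightarrow> 'a"
begin

text \<open>Leading coefficients multiply, so operators over a domain have no zero divisors. The
  resulting right cancellation makes \<open>conjD\<close> well defined.\<close>

lemma dmult_nonzero: "A \<noteq> 0 \<Longrightarrow> B \<noteq> 0 \<Longrightarrow> A \<star> B \<noteq> 0"
  using coeff_dmult_top[of A B] by (metis coeff_0 leading_coeff_0_iff mult_eq_0_iff)

lemma dmult_cancel_left: "A \<noteq> 0 \<Longrightarrow> A \<star> B = A \<star> C \<Longrightarrow> B = C"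
  using dmult_nonzero[of A "B - C"] by (auto simp: dmult_diff_right)

lemma dmult_cancel_right: "C \<noteq> 0 \<Longrightarrow> A \<star> C = B \<star> C \<Longrightarrow> A = B"
  using dmult_nonzero[of "A - B" C] by (auto simp: dmult_diff_left)

end

section \<open>Differential operators with polynomial and rational coefficients\<close>

text \<open>\<open>rderiv\<close> reads off the reduced fraction. Differentiating the cross product
  a' b = a b' shows that the quotient rule gives the same value on every representative.\<close>

lemma rderiv_Fract:
  assumes b: "b \<noteq> 0"
  shows "rderiv (Fract a b) = Fract (pderiv a * b - a * pderiv b) (b * b)"
proof -
  obtain a' b' where q: "quot_of_fract (Fract a b) = (a', b')"
    by fastforce
  have b': "b' \<noteq> 0"
    by (metis q snd_conv snd_quot_of_fract_nonzero)
  have "Fract a' b' = Fract a b"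
    by (metis q Fract_quot_of_fract fst_conv snd_conv)
  then have e: "a' * b = a * b'"
    using b b' by (simp add: eq_fract)
  have "pderiv (a' * b) = pderiv (a * b')"
    by (simp add: e)
  then have e': "a' * pderiv b + b * pderiv a' = a * pderiv b' + b' * pderiv a"
    by (simp add: pderiv_mult)
  have "(pderiv a' * b' - a' * pderiv b') * (b * b)
      = (b * pderiv a') * (b * b') - (a' * b) * b * pderiv b'"
    by (simp add: algebra_simps)
  also have "\<dots> = (a * pderiv b' + b' * pderiv a - a' * pderiv b) * (b * b') - (a * b') * b * pderiv b'"
    using e' by (simp only: e) (simp add: eq_diff_eq add.commute)
  also have "\<dots> = b' * pderiv a * (b * b') - (a' * b) * pderiv b * b'"
    by (simp add: algebra_simps)
  also have "\<dots> = (pderiv a * b - a * pderiv b) * (b' * b')"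
    by (simp only: e) (simp add: algebra_simps)
  finally show ?thesis
    using b b' by (simp add: rderiv_def q eq_fract)
qed

lemma rderiv_add: "rderiv (p + q) = rderiv p + rderiv q"
proof -
  obtain a b c e where "p = Fract a b" "b \<noteq> 0" "q = Fract c e" "e \<noteq> 0"
    by (metis Fract_cases)
  then show ?thesis
    by (simp add: rderiv_Fract eq_fract pderiv_add pderiv_mult) (simp add: algebra_simps)
qed

lemma rderiv_mult: "rderiv (p * q) = rderiv p * q + p * rderiv q"
proof -
  obtain a b c e where "p = Fract a b" "b \<noteq> 0" "q = Fract c e" "e \<noteq> 0"
    by (metis Fract_cases)
  then show ?thesis
    by (simp add: rderiv_Fract eq_fract pderiv_mult) (simp add: algebra_simps)
qed

interpretation W: domain_derivation "pderiv :: complex poly \<Rightarrow> complex poly"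
  rewrites "dmult (pderiv :: complex poly \<Rightarrow> complex poly) = wmult"
  by unfold_locales (simp_all add: pderiv_add pderiv_mult wmult_def algebra_simps)

interpretation R: domain_derivation rderiv
  rewrites "dmult rderiv = Dmult"
  by unfold_locales (simp_all add: rderiv_add rderiv_mult Dmult_def)

section \<open>Evaluation of rational functions outside their poles\<close>

lemma rdefined_Fract:
  assumes "poly b x \<noteq> 0"
  shows "rdefined (Fract a b) x" "reval (Fract a b) x = poly a x / poly b x"
proof -
  obtain a' b' where q: "quot_of_fract (Fract a b) = (a', b')"
    by fastforce
  have b: "b \<noteq> 0"
    using assms by auto
  have b': "b' \<noteq> 0"
    by (metis q snd_conv snd_quot_of_fract_nonzero)
  have "Fract a' b' = Fract a b"
    by (metis q Fract_quot_of_fract fst_conv snd_conv)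
  then have e: "a' * b = a * b'"
    using b b' by (simp add: eq_fract)
  then have ex: "poly a' x * poly b x = poly a x * poly b' x"
    by (metis poly_mult)
  have cop: "coprime a' b'"
    by (metis q coprime_quot_of_fract fst_conv snd_conv)
  \<comment> \<open>By a' b = a b' and b(x) nonzero, a zero of the reduced denominator would also be
    a zero of the reduced numerator, against coprimality.\<close>
  have b'x: "poly b' x \<noteq> 0"
  proof
    assume "poly b' x = 0"
    with ex assms have "poly a' x = 0" by simp
    with \<open>poly b' x = 0\<close> have "[:-x, 1:] dvd a'" "[:-x, 1:] dvd b'"
      by (simp_all add: poly_eq_0_iff_dvd)
    with cop have "is_unit [:-x, 1:]"
      by (rule coprime_common_divisor)
    then show False
      by (simp add: is_unit_iff_degree)
  qed
  then show "rdefined (Fract a b) x"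
    by (simp add: rdefined_def q)
  show "reval (Fract a b) x = poly a x / poly b x"
    using ex b'x assms by (simp add: reval_def q frac_eq_eq)
qed

lemma rdefinedE:
  assumes "rdefined q x"
  obtains a b where "q = Fract a b" "poly b x \<noteq> 0" "b \<noteq> 0"
proof (rule that)
  show "q = Fract (fst (quot_of_fract q)) (snd (quot_of_fract q))" by simp
  show "poly (snd (quot_of_fract q)) x \<noteq> 0"
    using assms by (simp add: rdefined_def)
qed simp

lemma
  assumes "rdefined p x" "rdefined q x"
  shows rdefined_add: "rdefined (p + q) x" and reval_add: "reval (p + q) x = reval p x + reval q x"
    and rdefined_mult: "rdefined (p * q) x" and reval_mult: "reval (p * q) x = reval p x * reval q x"
proof -
  obtain a b where p: "p = Fract a b" "poly b x \<noteq> 0" "b \<noteq> 0"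
    using assms(1) by (rule rdefinedE)
  obtain c e where q: "q = Fract c e" "poly e x \<noteq> 0" "e \<noteq> 0"
    using assms(2) by (rule rdefinedE)
  have add: "p + q = Fract (a * e + c * b) (b * e)" and mult: "p * q = Fract (a * c) (b * e)"
    using p q by simp_all
  have be: "poly (b * e) x \<noteq> 0"
    using p q by simp
  show "rdefined (p + q) x" "rdefined (p * q) x"
    unfolding add mult by (simp_all only: rdefined_Fract[OF be])
  show "reval (p + q) x = reval p x + reval q x" "reval (p * q) x = reval p x * reval q x"
    unfolding add mult rdefined_Fract[OF be] using p q
    by (simp_all add: rdefined_Fract add_frac_eq)
qed

lemma rdefined_0 [simp]: "rdefined 0 x"
  by (simp add: rdefined_def)

lemma reval_0 [simp]: "reval 0 x = 0"
  by (simp add: reval_def)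

lemma rdefined_rderiv:
  assumes "rdefined q x"
  shows "rdefined (rderiv q) x"
  using assms
  by (elim rdefinedE) (simp add: rderiv_Fract rdefined_Fract)

lemma reval_has_derivative:
  assumes "rdefined q x"
  shows "(reval q has_field_derivative reval (rderiv q) x) (at x)"
proof -
  obtain a b where q: "quot_of_fract q = (a, b)"
    by fastforce
  have bx: "poly b x \<noteq> 0"
    using assms by (simp add: rdefined_def q)
  have "((\<lambda>y. poly a y / poly b y) has_field_derivative
      (poly (pderiv a) x * poly b x - poly a x * poly (pderiv b) x) / (poly b x * poly b x)) (at x)"
    using bx by (auto intro!: derivative_eq_intros)
  moreover have "reval q = (\<lambda>y. poly a y / poly b y)"
    by (simp add: reval_def q fun_eq_iff)
  moreover have "reval (rderiv q) x
      = (poly (pderiv a) x * poly b x - poly a x * poly (pderiv b) x) / (poly b x * poly b x)"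
    using bx by (simp add: rderiv_def q rdefined_Fract)
  ultimately show ?thesis by simp
qed

lemma open_rdefined: "open {x. rdefined q x}"
proof -
  have "{x. rdefined q x} = - {x. poly (snd (quot_of_fract q)) x = 0}"
    by (auto simp: rdefined_def)
  moreover have "finite {x. poly (snd (quot_of_fract q)) x = 0}"
    by (rule poly_roots_finite) simp
  ultimately show ?thesis
    by (simp add: finite_imp_closed open_Compl)
qed

section \<open>Action of operators with rational coefficients on holomorphic functions\<close>

lemma D_defined_at_iff: "D_defined_at A x \<longleftrightarrow> (\<forall>i\<le>degree A. rdefined (coeff A i) x)"
  unfolding D_defined_at_def by (metis coeff_eq_0 not_le rdefined_0)

lemma open_D_defined: "open {x. D_defined_at A x}"
proof -
  have "{x. D_defined_at A x} = (\<Inter>i\<in>{..degree A}. {x. rdefined (coeff A i) x})"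
    by (auto simp: D_defined_at_iff)
  then show ?thesis
    by (simp add: open_INT open_rdefined)
qed

lemma D_defined_at_0 [simp]: "D_defined_at 0 x"
  by (simp add: D_defined_at_def)

lemma D_defined_at_add: "D_defined_at A x \<Longrightarrow> D_defined_at B x \<Longrightarrow> D_defined_at (A + B) x"
  by (simp add: D_defined_at_def rdefined_add)

lemma D_defined_at_smult: "rdefined c x \<Longrightarrow> D_defined_at A x \<Longrightarrow> D_defined_at (smult c A) x"
  by (simp add: D_defined_at_def rdefined_mult)

lemma D_defined_at_dd: "D_defined_at A x \<Longrightarrow> D_defined_at (R.dd A) x"
  unfolding D_defined_at_def
  by (auto simp: R.coeff_dd split: nat.split intro!: rdefined_add rdefined_rderiv)

lemma D_defined_at_ddpow: "D_defined_at A x \<Longrightarrow> D_defined_at ((R.dd ^^ i) A) x"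
  by (induction i) (simp_all add: D_defined_at_dd)

lemma D_apply_bound:
  "degree A \<le> m \<Longrightarrow> D_apply A u x = (\<Sum>i\<le>m. reval (coeff A i) x * (deriv ^^ i) u x)"
  unfolding D_apply_def by (intro sum.mono_neutral_left) (auto simp: coeff_eq_0)

lemma D_apply_0 [simp]: "D_apply 0 u x = 0"
  by (simp add: D_apply_def)

lemma D_apply_add:
  assumes "D_defined_at A x" "D_defined_at B x"
  shows "D_apply (A + B) u x = D_apply A u x + D_apply B u x"
  using assms
  by (subst (1 2 3) D_apply_bound[where m = "max (degree A) (degree B)"])
     (auto simp: degree_add_le D_defined_at_def reval_add ring_distribs sum.distrib)

lemma D_apply_smult:
  assumes "rdefined c x" "D_defined_at A x"
  shows "D_apply (smult c A) u x = reval c x * D_apply A u x"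
  using assms
  by (subst (1 2) D_apply_bound[where m = "degree A"])
     (auto simp: degree_smult_le D_defined_at_def reval_mult sum_distrib_left mult.assoc)

lemma D_apply_sum:
  assumes "\<And>s. s \<in> S \<Longrightarrow> D_defined_at (F s) x"
  shows "D_apply (sum F S) u x = (\<Sum>s\<in>S. D_apply (F s) u x) \<and> D_defined_at (sum F S) x"
  using assms
  by (induction S rule: infinite_finite_induct) (simp_all add: D_apply_add D_defined_at_add)

text \<open>The product rule splits in the same way as \<open>dd\<close>: the derivative falls on a
  coefficient, or it raises the order of a derivative of \<open>u\<close>.\<close>

lemma D_apply_has_derivative:
  assumes U: "open U" "u holomorphic_on U" "x \<in> U" and A: "D_defined_at A x"
  shows "(D_apply A u has_field_derivative D_apply (R.dd A) u x) (at x)"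
proof -
  have du: "((deriv ^^ i) u has_field_derivative (deriv ^^ Suc i) u x) (at x)" for i
    using holomorphic_derivI[OF holomorphic_higher_deriv[OF U(2,1)] U(1,3)] by simp
  have "((\<lambda>y. \<Sum>i\<le>degree A. reval (coeff A i) y * (deriv ^^ i) u y) has_field_derivative
      (\<Sum>i\<le>degree A. reval (rderiv (coeff A i)) x * (deriv ^^ i) u x
         + (deriv ^^ Suc i) u x * reval (coeff A i) x)) (at x)"
    using A unfolding D_defined_at_def
    by (intro DERIV_sum DERIV_mult reval_has_derivative du) auto
  moreover have "D_apply (R.dd A) u x
     = (\<Sum>i\<le>degree A. reval (rderiv (coeff A i)) x * (deriv ^^ i) u x
         + (deriv ^^ Suc i) u x * reval (coeff A i) x)"
  proof -
    let ?c = "\<lambda>i. case i of 0 \<Rightarrow> 0 | Suc j \<Rightarrow> coeff A j"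
    have c: "rdefined (?c i) x" for i
      using A by (auto simp: D_defined_at_def split: nat.split)
    have "degree (R.dd A) \<le> Suc (degree A)"
      using R.degree_ddpow_le[of 1 A] by simp
    then have "D_apply (R.dd A) u x
        = (\<Sum>i\<le>Suc (degree A). reval (rderiv (coeff A i)) x * (deriv ^^ i) u x)
        + (\<Sum>i\<le>Suc (degree A). reval (?c i) x * (deriv ^^ i) u x)"
      using A c by (simp only: D_apply_bound R.coeff_dd D_defined_at_def reval_add rdefined_rderiv
          ring_distribs sum.distrib)
    also have "(\<Sum>i\<le>Suc (degree A). reval (rderiv (coeff A i)) x * (deriv ^^ i) u x)
        = (\<Sum>i\<le>degree A. reval (rderiv (coeff A i)) x * (deriv ^^ i) u x)"
      by (simp add: coeff_eq_0)
    also have "(\<Sum>i\<le>Suc (degree A). reval (?c i) x * (deriv ^^ i) u x)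
        = (\<Sum>i\<le>degree A. reval (coeff A i) x * (deriv ^^ Suc i) u x)"
      by (subst sum.atMost_Suc_shift) simp
    finally show ?thesis
      by (simp add: sum.distrib mult.commute)
  qed
  ultimately show ?thesis
    by (simp add: D_apply_def[abs_def])
qed

lemma higher_deriv_D_apply:
  assumes U: "open U" "u holomorphic_on U" and A: "\<And>y. y \<in> U \<Longrightarrow> D_defined_at A y"
    and "x \<in> U"
  shows "(deriv ^^ i) (D_apply A u) x = D_apply ((R.dd ^^ i) A) u x"
  using \<open>x \<in> U\<close>
proof (induction i arbitrary: x)
  case (Suc i)
  have "(D_apply ((R.dd ^^ i) A) u has_field_derivative D_apply ((R.dd ^^ Suc i) A) u x) (at x)"
    using D_apply_has_derivative[OF U Suc.prems] A Suc.prems by (simp add: D_defined_at_ddpow)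
  then have "((deriv ^^ i) (D_apply A u) has_field_derivative D_apply ((R.dd ^^ Suc i) A) u x) (at x)"
    by (rule has_field_derivative_transform_within_open[OF _ U(1) Suc.prems]) (simp add: Suc.IH)
  then show ?case
    by (simp add: DERIV_imp_deriv)
qed simp

lemma D_apply_Dmult:
  assumes U: "open U" "u holomorphic_on U" "x \<in> U"
    and A: "D_defined_at A x" and B: "D_defined_at B x"
  shows "D_apply (Dmult A B) u x = D_apply A (D_apply B u) x"
proof -
  \<comment> \<open>Derivatives of \<open>D_apply B u\<close> at \<open>x\<close> depend on a whole
    neighbourhood, which must avoid the poles of \<open>B\<close>; these form a closed set.\<close>
  let ?V = "U \<inter> {y. D_defined_at B y}"
  have "open ?V" "u holomorphic_on ?V" "x \<in> ?V"
    using U B open_D_defined by (auto intro: holomorphic_on_subset)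
  then have h: "(deriv ^^ i) (D_apply B u) x = D_apply ((R.dd ^^ i) B) u x" for i
    by (intro higher_deriv_D_apply[of ?V]) auto
  have "D_apply (Dmult A B) u x = (\<Sum>i\<le>degree A. D_apply (smult (coeff A i) ((R.dd ^^ i) B)) u x)"
    unfolding R.dmult_dd using A B
    by (subst D_apply_sum[THEN conjunct1])
       (auto intro!: D_defined_at_smult D_defined_at_ddpow simp: D_defined_at_def[of A])
  also have "\<dots> = (\<Sum>i\<le>degree A. reval (coeff A i) x * D_apply ((R.dd ^^ i) B) u x)"
    using A B by (intro sum.cong D_apply_smult D_defined_at_ddpow) (auto simp: D_defined_at_def[of A])
  finally show ?thesis
    by (simp add: D_apply_def[of A] h)
qed

lemma D_apply_cong:
  assumes "open U" "x \<in> U" "\<And>y. y \<in> U \<Longrightarrow> u y = v y"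
  shows "D_apply A u x = D_apply A v x"
proof -
  have "(deriv ^^ i) u y = (deriv ^^ i) v y" if "y \<in> U" for i y
    using that
  proof (induction i arbitrary: y)
    case (Suc i)
    then have "eventually (\<lambda>y. (deriv ^^ i) u y = (deriv ^^ i) v y) (nhds y)"
      using assms(1) by (auto simp: eventually_nhds)
    then show ?case
      by (auto intro: deriv_cong_ev)
  qed (use assms in auto)
  then show ?thesis
    using assms by (simp add: D_apply_def)
qed

section \<open>The Weyl algebra inside the operators with rational coefficients\<close>

lemma coeff_embed [simp]: "coeff (embed T) i = Fract (coeff T i) 1"
  by (simp add: embed_def coeff_map_poly fract_collapse)

lemma degree_embed [simp]: "degree (embed T) = degree T"
  unfolding embed_def by (rule degree_map_poly) (simp add: Zero_fract_def eq_fract)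

lemma embed_0 [simp]: "embed 0 = 0"
  by (rule poly_eqI) (simp add: fract_collapse)

lemma embed_1 [simp]: "embed 1 = 1"
  by (rule poly_eqI) (simp add: fract_collapse)

lemma embed_eq_iff [simp]: "embed A = embed B \<longleftrightarrow> A = B"
  by (auto simp: poly_eq_iff eq_fract)

lemma embed_eq_0_iff [simp]: "embed A = 0 \<longleftrightarrow> A = 0"
  using embed_eq_iff[of A 0] by simp

lemma embed_add: "embed (A + B) = embed A + embed B"
  by (rule poly_eqI) simp

lemma embed_smult: "embed (smult c A) = smult (Fract c 1) (embed A)"
  by (rule poly_eqI) simp

lemma embed_uminus: "embed (- A) = - embed A"
  by (rule poly_eqI) simp

lemma embed_const: "embed [:c:] = [:Fract c 1:]"
  by (rule poly_eqI) (simp add: coeff_pCons fract_collapse split: nat.split)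

lemma embed_sum: "embed (sum F S) = (\<Sum>s\<in>S. embed (F s))"
  by (induction S rule: infinite_finite_induct) (simp_all add: embed_add)

lemma embed_dd: "embed (W.dd A) = R.dd (embed A)"
  by (rule poly_eqI) (simp add: W.coeff_dd R.coeff_dd rderiv_Fract fract_collapse split: nat.split)

lemma embed_ddpow: "embed ((W.dd ^^ i) A) = (R.dd ^^ i) (embed A)"
  by (induction i) (simp_all add: embed_dd)

lemma embed_wmult: "embed (wmult A B) = Dmult (embed A) (embed B)"
  by (simp add: W.dmult_dd R.dmult_dd embed_sum embed_smult embed_ddpow)

lemma D_defined_at_embed [simp]: "D_defined_at (embed A) x"
  by (simp add: D_defined_at_def rdefined_Fract)

lemma D_apply_embed: "D_apply (embed A) = weyl_apply A"
  by (simp add: fun_eq_iff D_apply_def weyl_apply_def rdefined_Fract)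

lemma weyl_apply_wmult:
  assumes "u holomorphic_on UNIV"
  shows "weyl_apply (wmult A B) u = weyl_apply A (weyl_apply B u)"
  using D_apply_Dmult[OF open_UNIV assms UNIV_I, of "embed A" _ "embed B"]
  by (simp add: fun_eq_iff D_apply_embed flip: embed_wmult)

lemma weyl_apply_bound:
  "degree A \<le> m \<Longrightarrow> weyl_apply A u x = (\<Sum>i\<le>m. poly (coeff A i) x * (deriv ^^ i) u x)"
  unfolding weyl_apply_def by (intro sum.mono_neutral_left) (auto simp: coeff_eq_0)

lemma weyl_apply_0 [simp]: "weyl_apply 0 u x = 0"
  by (simp add: weyl_apply_def)

lemma weyl_apply_add: "weyl_apply (A + B) u x = weyl_apply A u x + weyl_apply B u x"
  by (simp add: D_apply_add embed_add flip: D_apply_embed)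

lemma weyl_apply_smult: "weyl_apply (smult c A) u x = poly c x * weyl_apply A u x"
  by (simp add: D_apply_smult embed_smult rdefined_Fract flip: D_apply_embed)

lemma weyl_apply_sum: "weyl_apply (sum F S) u x = (\<Sum>s\<in>S. weyl_apply (F s) u x)"
  by (induction S rule: infinite_finite_induct) (simp_all add: weyl_apply_add)

lemma weyl_apply_minus: "weyl_apply (- A) u x = - weyl_apply A u x"
  using weyl_apply_add[of A "-A" u x] by (simp add: eq_neg_iff_add_eq_0 add.commute)

lemma weyl_apply_diff: "weyl_apply (A - B) u x = weyl_apply A u x - weyl_apply B u x"
  using weyl_apply_add[of A "-B" u x] by (simp add: weyl_apply_minus)

lemma weyl_apply_monom: "weyl_apply (monom c i) u x = poly c x * (deriv ^^ i) u x"
proof -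
  have e: "poly (if i = j then c else 0) x * (deriv ^^ j) u x
      = (if j = i then poly c x * (deriv ^^ i) u x else 0)" for j
    by simp
  have "weyl_apply (monom c i) u x = (\<Sum>j\<le>i. if j = i then poly c x * (deriv ^^ i) u x else 0)"
    unfolding e[symmetric] by (subst weyl_apply_bound[where m = i]) (auto simp: degree_monom_le intro!: sum.cong)
  then show ?thesis by simp
qed

lemma higher_deriv_sum:
  fixes u :: "'i \<Rightarrow> complex \<Rightarrow> complex"
  assumes "\<And>s. s \<in> S \<Longrightarrow> u s holomorphic_on UNIV"
  shows "(deriv ^^ i) (\<lambda>y. \<Sum>s\<in>S. c s * u s y) x = (\<Sum>s\<in>S. c s * (deriv ^^ i) (u s) x)"
  using assms
proof (induction S rule: infinite_finite_induct)
  case (insert s S)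
  have "(deriv ^^ i) (\<lambda>y. c s * u s y + (\<Sum>s\<in>S. c s * u s y)) x
      = (deriv ^^ i) (\<lambda>y. c s * u s y) x + (deriv ^^ i) (\<lambda>y. \<Sum>s\<in>S. c s * u s y) x"
    using insert.prems by (intro higher_deriv_add[of _ UNIV]) (auto intro!: holomorphic_intros)
  also have "(deriv ^^ i) (\<lambda>y. c s * u s y) x = c s * (deriv ^^ i) (u s) x"
    using insert.prems by (intro higher_deriv_cmult[of _ UNIV]) (auto intro!: holomorphic_intros)
  finally show ?case
    using insert by simp
qed (auto simp: higher_deriv_const[of 0, simplified])

lemma weyl_apply_lincomb:
  fixes u :: "'i \<Rightarrow> complex \<Rightarrow> complex"
  assumes "\<And>s. s \<in> S \<Longrightarrow> u s holomorphic_on UNIV"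
  shows "weyl_apply A (\<lambda>y. \<Sum>s\<in>S. c s * u s y) x = (\<Sum>s\<in>S. c s * weyl_apply A (u s) x)"
proof -
  have "weyl_apply A (\<lambda>y. \<Sum>s\<in>S. c s * u s y) x
      = (\<Sum>i\<le>degree A. \<Sum>s\<in>S. c s * (poly (coeff A i) x * (deriv ^^ i) (u s) x))"
    by (simp add: weyl_apply_def higher_deriv_sum[OF assms] sum_distrib_left mult.left_commute)
  also have "\<dots> = (\<Sum>s\<in>S. \<Sum>i\<le>degree A. c s * (poly (coeff A i) x * (deriv ^^ i) (u s) x))"
    by (rule sum.swap)
  finally show ?thesis
    by (simp add: weyl_apply_def sum_distrib_left)
qed

section \<open>Polynomials in an operator and the bispectral anti-automorphism\<close>

abbreviation wpartial :: weyl where "wpartial \<equiv> monom 1 (Suc 0)"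

lemma wmult_smult_const: "wmult A (smult [:c:] B) = smult [:c:] (wmult A B)"
proof -
  have "(W.dd ^^ i) (smult [:c:] B) = smult [:c:] ((W.dd ^^ i) B)" for i
    by (induction i) (simp_all add: W.dd_smult pderiv_pCons)
  then show ?thesis
    by (simp add: W.dmult_dd smult_sum_right mult.commute)
qed

lemma weval_bound:
  "degree p \<le> m \<Longrightarrow> weval L p = (\<Sum>k\<le>m. smult [:coeff p k:] (dpow pderiv L k))"
  unfolding weval_def by (intro sum.mono_neutral_left) (auto simp: coeff_eq_0)

lemma weval_0 [simp]: "weval L 0 = 0"
  by (simp add: weval_def)

lemma weval_const [simp]: "weval L [:c:] = [:[:c:]:]"
  by (simp add: weval_def)

lemma weval_1 [simp]: "weval L 1 = 1"
  using weval_const[of L 1] by (simp only: one_pCons)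

lemma weval_add: "weval L (p + q) = weval L p + weval L q"
proof -
  have "[:c + e:] = [:c:] + [:e:]" for c e :: complex
    by simp
  then show ?thesis
    by (subst (1 2 3) weval_bound[where m = "max (degree p) (degree q)"])
       (simp_all only: degree_add_le max.cobounded1 max.cobounded2 coeff_add smult_add_left sum.distrib)
qed

lemma weval_smult: "weval L (smult c p) = smult [:c:] (weval L p)"
proof -
  have "[:c * e:] = [:c:] * [:e:]" for c e :: complex
    by simp
  then show ?thesis
    by (subst (1 2) weval_bound[where m = "degree p"])
       (simp_all only: degree_smult_le order_refl coeff_smult smult_smult[symmetric] smult_sum_right)
qed

lemma weval_uminus: "weval L (- p) = - weval L p"
  using weval_add[of L "-p" p] by (simp add: eq_neg_iff_add_eq_0)

lemma weval_pCons_0: "weval L (pCons 0 p) = wmult L (weval L p)"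
proof -
  have "weval L (pCons 0 p) = (\<Sum>k\<le>Suc (degree p). smult [:coeff (pCons 0 p) k:] (dpow pderiv L k))"
    by (rule weval_bound) (rule degree_pCons_le)
  also have "\<dots> = (\<Sum>k\<le>degree p. smult [:coeff p k:] (wmult L (dpow pderiv L k)))"
    by (subst sum.atMost_Suc_shift) (simp add: wmult_def)
  also have "\<dots> = wmult L (weval L p)"
    by (simp add: weval_def W.dmult_sum_right wmult_smult_const)
  finally show ?thesis .
qed

lemma weval_pCons: "weval L (pCons c p) = [:[:c:]:] + wmult L (weval L p)"
proof -
  have "pCons c p = [:c:] + pCons 0 p" by simp
  then show ?thesis by (simp only: weval_add weval_const weval_pCons_0)
qed

lemma weval_X: "weval L [:0, 1:] = L"
  by (simp add: weval_pCons_0 flip: one_pCons)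

lemma weval_mult: "weval L (p * q) = wmult (weval L p) (weval L q)"
  by (induction p)
     (simp_all add: weval_add weval_smult weval_pCons weval_pCons_0 W.dmult_add_left W.dmult_const_left W.dmult_assoc)

lemma weval_commute: "wmult (weval L p) (weval L q) = wmult (weval L q) (weval L p)"
  by (simp add: mult.commute flip: weval_mult)

lemma wmult_partial_right: "wmult A (monom 1 i) = (\<Sum>j\<le>degree A. monom (coeff A j) (j + i))"
proof -
  have "wmult A (monom 1 i) = wmult (\<Sum>j\<le>degree A. monom (coeff A j) j) (monom 1 i)"
    by (simp add: poly_as_sum_of_monoms)
  then show ?thesis
    by (simp add: W.dmult_sum_left W.dmult_monom_monom1)
qed

lemma wmult_partial_right1: "wmult A wpartial = pCons 0 A"
proof -
  have "pCons 0 A = pCons 0 (\<Sum>j\<le>degree A. monom (coeff A j) j)"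
    by (simp add: poly_as_sum_of_monoms)
  also have "\<dots> = (\<Sum>j\<le>degree A. monom (coeff A j) (Suc j))"
    by (rule poly_eqI) (auto simp: coeff_sum coeff_pCons split: nat.split)
  finally show ?thesis
    by (simp add: wmult_partial_right)
qed

lemma coeff_L0:
  "coeff (L0 r a) k = (if k = r then 1 else 0) - (if k \<in> {1..r-2} then [:a k:] else 0)
     - (if k = 0 then [:0, 1:] else 0)"
proof -
  have "(\<Sum>i\<in>{1..r-2}. coeff (monom [:a i:] i) k) = (if k \<in> {1..r-2} then [:a k:] else 0)"
    by (simp add: sum.delta)
  then show ?thesis
    by (auto simp: L0_def coeff_sum coeff_pCons split: nat.split)
qed

section \<open>The anti-automorphism flat\<close>

context
  fixes r :: nat and a :: "nat \<Rightarrow> complex"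
begin

text \<open>The only non-constant term in \<open>L0\<close> is -x, hence [L0, \<partial>] = 1. This
  is [\<partial>, x] = 1 with the factors reversed and x replaced by L0, the relation on which flat
  rests.\<close>

lemma partial_L0: "wmult wpartial (L0 r a) + 1 = wmult (L0 r a) wpartial"
proof (rule poly_eqI)
  fix k
  have "pderiv (coeff (L0 r a) k) = (if k = 0 then -1 else 0)"
    by (auto simp: coeff_L0 pderiv_diff pderiv_pCons one_pCons)
  then show "coeff (wmult wpartial (L0 r a) + 1) k = coeff (wmult (L0 r a) wpartial) k"
    by (auto simp: W.dmult_monom1 wmult_partial_right1 W.coeff_dd coeff_pCons split: nat.split)
qed

text \<open>The commutator [p(L0), \<partial>] = p'(L0) mirrors \<partial> p = p \<partial> + p'
  with the order of the factors reversed.\<close>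

lemma partial_weval: "wmult wpartial (weval (L0 r a) p) + weval (L0 r a) (pderiv p) = wmult (weval (L0 r a) p) wpartial"
proof (induction p)
  case (pCons c p)
  let ?P = "weval (L0 r a) p"
  have "wmult wpartial (weval (L0 r a) (pCons c p)) + weval (L0 r a) (pderiv (pCons c p))
      = smult [:c:] wpartial + (wmult (wmult wpartial (L0 r a)) ?P + ?P + wmult (L0 r a) (weval (L0 r a) (pderiv p)))"
    by (simp add: weval_pCons W.dmult_add_right pderiv_pCons weval_add weval_pCons_0 W.dmult_assoc
        W.dmult_monom1[of "Suc 0", simplified] W.dd_monom W.dmult_dd_left flip: monom_0)
       (simp add: monom_0 smult_monom)
  also have "wmult (wmult wpartial (L0 r a)) ?P + ?P = wmult (wmult wpartial (L0 r a) + 1) ?P"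
    by (simp add: W.dmult_add_left)
  also have "\<dots> + wmult (L0 r a) (weval (L0 r a) (pderiv p)) = wmult (L0 r a) (wmult wpartial ?P + weval (L0 r a) (pderiv p))"
    by (simp add: partial_L0 W.dmult_add_right W.dmult_assoc)
  also have "\<dots> = wmult (wmult (L0 r a) ?P) wpartial"
    by (simp add: pCons.IH W.dmult_assoc)
  finally show ?case
    by (simp add: weval_pCons W.dmult_add_left W.dmult_const_left)
qed simp

lemma wflat_bound:
  "degree T \<le> m \<Longrightarrow> wflat r a T = (\<Sum>i\<le>m. wmult (monom 1 i) (weval (L0 r a) (coeff T i)))"
  unfolding wflat_def by (intro sum.mono_neutral_left) (auto simp: coeff_eq_0)

lemma wflat_add: "wflat r a (A + B) = wflat r a A + wflat r a B"
  by (subst (1 2 3) wflat_bound[where m = "max (degree A) (degree B)"])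
     (simp_all add: degree_add_le weval_add W.dmult_add_right sum.distrib)

lemma wflat_0 [simp]: "wflat r a 0 = 0"
  by (simp add: wflat_def)

lemma wflat_uminus: "wflat r a (- A) = - wflat r a A"
  using wflat_add[of "-A" A] by (simp add: eq_neg_iff_add_eq_0)

lemma wflat_diff: "wflat r a (A - B) = wflat r a A - wflat r a B"
  using wflat_add[of A "-B"] by (simp add: wflat_uminus)

lemma wflat_sum: "wflat r a (sum F S) = (\<Sum>s\<in>S. wflat r a (F s))"
  by (induction S rule: infinite_finite_induct) (simp_all add: wflat_add)

lemma wflat_smult: "wflat r a (smult c T) = wmult (wflat r a T) (weval (L0 r a) c)"
  by (subst (1 2) wflat_bound[where m = "degree T"])
     (simp_all add: degree_smult_le W.dmult_sum_left W.dmult_assoc weval_mult weval_commute[of _ c])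

lemma wflat_monom: "wflat r a (monom c i) = wmult (monom 1 i) (weval (L0 r a) c)"
proof -
  have e: "wmult (monom 1 j) (weval (L0 r a) (if i = j then c else 0))
      = (if j = i then wmult (monom 1 i) (weval (L0 r a) c) else 0)" for j
    by simp
  have "wflat r a (monom c i) = (\<Sum>j\<le>i. if j = i then wmult (monom 1 i) (weval (L0 r a) c) else 0)"
    unfolding e[symmetric] by (subst wflat_bound[where m = i]) (auto simp: degree_monom_le)
  then show ?thesis by simp
qed

lemma wflat_const: "wflat r a [:c:] = weval (L0 r a) c"
  using wflat_monom[of c 0] by (simp add: monom_0 flip: one_pCons)

text \<open>As \<open>dd T\<close> is the composite of \<partial> with \<open>T\<close>, this is the
  anti-homomorphism law for a left factor \<partial>. Together with \<open>wflat_smult\<close>, the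
  law for polynomial left factors, it yields \<open>wflat_wmult\<close>.\<close>

lemma wflat_dd: "wflat r a (W.dd T) = wmult (wflat r a T) wpartial"
proof -
  have m: "wflat r a (W.dd (monom c i)) = wmult (wflat r a (monom c i)) wpartial" for c i
  proof -
    have "wflat r a (W.dd (monom c i))
        = wmult (monom 1 i) (wmult wpartial (weval (L0 r a) c) + weval (L0 r a) (pderiv c))"
      by (simp add: W.dd_monom wflat_add wflat_monom W.dmult_add_right W.dmult_monom_monom1
          flip: W.dmult_assoc)
    then show ?thesis
      by (simp add: partial_weval wflat_monom W.dmult_assoc)
  qed
  have "wflat r a (W.dd (\<Sum>i\<le>degree T. monom (coeff T i) i))
      = wmult (wflat r a (\<Sum>i\<le>degree T. monom (coeff T i) i)) wpartial"
    by (simp add: W.dd_sum wflat_sum m W.dmult_sum_left)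
  then show ?thesis
    by (simp add: poly_as_sum_of_monoms)
qed

lemma wflat_ddpow: "wflat r a ((W.dd ^^ i) T) = wmult (wflat r a T) (monom 1 i)"
  by (induction i) (simp_all add: wflat_dd W.dmult_assoc W.dmult_monom_monom1 flip: one_pCons)

lemma wflat_wmult: "wflat r a (wmult A B) = wmult (wflat r a B) (wflat r a A)"
  by (simp add: W.dmult_dd[of A B] wflat_sum wflat_smult wflat_ddpow wflat_def[of r a A]
      W.dmult_sum_right W.dmult_assoc)

lemma wflat_monom_const: "wflat r a (monom [:c:] i) = monom [:c:] i"
proof -
  have "wmult (monom 1 i) (smult [:c:] 1) = smult [:c:] (monom 1 i)"
    by (subst wmult_smult_const) simp
  then show ?thesis
    by (simp add: wflat_monom smult_monom)
qed

text \<open>Constant coefficient operators are fixed by flat and L0 + x is one of them; since x goes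
  to L0, L0 must go to x. Flat is therefore an involution, which also makes it injective.\<close>

lemma wflat_L0: "wflat r a (L0 r a) = [:[:0, 1:]:]"
proof -
  have "wflat r a (monom 1 r) = monom 1 r"
    using wflat_monom_const[of 1 r] by (simp flip: one_pCons)
  then have "wflat r a (L0 r a) = L0 r a + [:[:0, 1:]:] - L0 r a"
    by (simp add: L0_def[of r a] wflat_diff wflat_sum wflat_monom_const wflat_const weval_X)
  then show ?thesis by simp
qed

lemma wflat_weval: "wflat r a (weval (L0 r a) p) = [:p:]"
proof (induction p)
  case (pCons c p)
  then show ?case
    by (simp add: weval_pCons wflat_add wflat_wmult wflat_L0 wflat_const W.dmult_const_left)
qed simp

lemma wflat_wflat: "wflat r a (wflat r a T) = T"
proof -
  have "wflat r a (wflat r a (monom c i)) = monom c i" for c i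
    using wflat_monom_const[of 1 i]
    by (simp add: wflat_monom wflat_wmult wflat_weval W.dmult_const_left smult_monom flip: one_pCons)
  then have "wflat r a (wflat r a (\<Sum>i\<le>degree T. monom (coeff T i) i))
      = (\<Sum>i\<le>degree T. monom (coeff T i) i)"
    by (simp add: wflat_sum)
  then show ?thesis
    by (simp add: poly_as_sum_of_monoms)
qed

lemma wflat_eq_0_iff: "wflat r a T = 0 \<longleftrightarrow> T = 0"
  by (metis wflat_0 wflat_wflat)

end

section \<open>Translated kernel functions as generalized eigenfunctions\<close>

lemma higher_deriv_shift: "(deriv ^^ i) (\<lambda>y. u (y + s)) = (\<lambda>y. (deriv ^^ i) u (y + s))"
  by (induction i) (simp_all add: deriv_def DERIV_shift)

lemma weyl_apply_const: "weyl_apply [:c:] u x = poly c x * u x"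
  using weyl_apply_monom[of c 0] by (simp add: monom_0)

lemma weyl_apply_L0:
  "weyl_apply (L0 r a) u x
     = (deriv ^^ r) u x - (\<Sum>k\<in>{1..r-2}. a k * (deriv ^^ k) u x) - x * u x"
  by (simp add: L0_def weyl_apply_diff weyl_apply_sum weyl_apply_monom weyl_apply_const)

text \<open>Only the term -x u notices a translation, and it does so by s u. Hence translating a
  kernel function by s produces the eigenvalue s.\<close>

lemma weyl_apply_L0_shift:
  "weyl_apply (L0 r a) (\<lambda>y. u (y + s)) x = weyl_apply (L0 r a) u (x + s) + s * u (x + s)"
  by (simp add: weyl_apply_L0 higher_deriv_shift algebra_simps)

lemma in_kerD:
  assumes "in_ker A u"
  shows "u holomorphic_on UNIV" "weyl_apply A u x = 0"
  using assms by (auto simp: in_ker_def)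

text \<open>Apply [L0, \<partial>] = 1 to a function that L0 annihilates: its derivative is a
  generalized eigenfunction.\<close>

lemma weyl_apply_L0_deriv:
  assumes "in_ker (L0 r a) u"
  shows "weyl_apply (L0 r a) (deriv u) x = u x"
proof -
  have u: "u holomorphic_on UNIV"
    using assms by (rule in_kerD)
  have "weyl_apply (wmult wpartial (L0 r a)) u x + weyl_apply 1 u x
      = weyl_apply (wmult (L0 r a) wpartial) u x"
    by (simp add: partial_L0 flip: weyl_apply_add)
  moreover have "weyl_apply (L0 r a) u = (\<lambda>_. 0)"
    using in_kerD(2)[OF assms] by auto
  moreover have "weyl_apply wpartial v = deriv v" for v
    using weyl_apply_monom[of 1 "Suc 0" v] by auto
  moreover have "weyl_apply 1 u x = u x"
    using weyl_apply_const[of 1 u x] by (simp flip: one_pCons)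
  ultimately show ?thesis
    by (simp add: weyl_apply_wmult[OF u])
qed

lemma weyl_apply_cmult:
  assumes "u holomorphic_on UNIV"
  shows "weyl_apply A (\<lambda>y. c * u y) x = c * weyl_apply A u x"
  using weyl_apply_lincomb[of "{()}" "\<lambda>_. u" A "\<lambda>_. c" x] assms by simp

lemma weyl_apply_weval_eigen:
  assumes u: "u holomorphic_on UNIV" and L: "\<And>x. weyl_apply L u x = s * u x"
  shows "weyl_apply (weval L p) u x = poly p s * u x"
proof (induction p arbitrary: x)
  case (pCons c p)
  then have "weyl_apply (weval L p) u = (\<lambda>x. poly p s * u x)"
    by auto
  then have "weyl_apply L (weyl_apply (weval L p) u) x = poly p s * (s * u x)"
    by (simp add: weyl_apply_cmult[OF u] L)
  then show ?case
    by (simp add: weval_pCons weyl_apply_add weyl_apply_const weyl_apply_wmult[OF u] algebra_simps)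
qed simp

text \<open>On the span of \<open>u\<close> and \<open>v\<close> the operator is a Jordan block of
  size two, so p of it carries p'(s) off the diagonal. This is the origin of the conditions
  p'(lam_i) = 0.\<close>

lemma weyl_apply_weval_generalized_eigen:
  assumes u: "u holomorphic_on UNIV" and Lu: "\<And>x. weyl_apply L u x = s * u x"
    and v: "v holomorphic_on UNIV" and Lv: "\<And>x. weyl_apply L v x = s * v x + u x"
  shows "weyl_apply (weval L p) v x = poly p s * v x + poly (pderiv p) s * u x"
proof (induction p arbitrary: x)
  case (pCons c p)
  \<comment> \<open>Indexing the pair by \<open>bool\<close> turns the two terms into one finite
    sum, to which \<open>weyl_apply_lincomb\<close> applies.\<close>
  let ?g = "\<lambda>b. if b then v else u" and ?c = "\<lambda>b. if b then poly p s else poly (pderiv p) s"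
  have "weyl_apply (weval L p) v = (\<lambda>x. \<Sum>b\<in>UNIV. ?c b * ?g b x)"
    using pCons by (auto simp: UNIV_bool)
  then have "weyl_apply L (weyl_apply (weval L p) v) x = (\<Sum>b\<in>UNIV. ?c b * weyl_apply L (?g b) x)"
    by (simp only:) (rule weyl_apply_lincomb, simp add: u v)
  then show ?case
    by (simp add: weval_pCons weyl_apply_add weyl_apply_const weyl_apply_wmult[OF v]
        Lu Lv UNIV_bool pderiv_pCons algebra_simps)
qed simp

lemma holomorphic_shift:
  assumes "u holomorphic_on UNIV"
  shows "(\<lambda>y. u (y + s)) holomorphic_on UNIV"
proof -
  have "(\<lambda>y. y + s) holomorphic_on UNIV"
    by (intro holomorphic_intros)
  from holomorphic_on_compose_gen[OF this assms] show ?thesis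
    by (simp add: o_def)
qed

lemma weval_L0_shift:
  assumes "in_ker (L0 r a) u"
  shows "weyl_apply (weval (L0 r a) p) (\<lambda>y. u (y + s)) x = poly p s * u (x + s)"
  using in_kerD[OF assms]
  by (intro weyl_apply_weval_eigen holomorphic_shift) (simp_all add: weyl_apply_L0_shift)

lemma weval_L0_deriv_shift:
  assumes "in_ker (L0 r a) u"
  shows "weyl_apply (weval (L0 r a) p) (\<lambda>y. deriv u (y + s)) x
      = poly p s * deriv u (x + s) + poly (pderiv p) s * u (x + s)"
  using in_kerD[OF assms]
  by (intro weyl_apply_weval_generalized_eigen[where u = "\<lambda>y. u (y + s)"] holomorphic_shift)
     (simp_all add: weyl_apply_L0_shift weyl_apply_L0_deriv[OF assms] holomorphic_deriv)

text \<open>On u(x + z) the derivatives in both variables agree, and multiplication by c(x) equals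
  c(L0) in the other variable because x is the eigenvalue there. The coefficients of
  \<open>T\<close> act after the derivatives, so the order of the factors is reversed.\<close>

lemma weyl_apply_wflat:
  assumes "in_ker (L0 r a) u"
  shows "weyl_apply T (\<lambda>y. u (y + z)) x = weyl_apply (wflat r a T) (\<lambda>w. u (x + w)) z"
proof -
  have h: "(\<lambda>w. u (w + x)) holomorphic_on UNIV"
    by (rule holomorphic_shift[OF in_kerD(1)[OF assms]])
  have "weyl_apply (weval (L0 r a) c) (\<lambda>w. u (w + x)) = (\<lambda>w. poly c x * u (w + x))" for c
    using weval_L0_shift[OF assms] by blast
  then have "weyl_apply (wmult (monom 1 i) (weval (L0 r a) c)) (\<lambda>w. u (w + x)) z
      = poly c x * (deriv ^^ i) u (x + z)" for i c
    by (simp add: weyl_apply_wmult[OF h])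
       (simp add: weyl_apply_cmult[OF h] weyl_apply_monom higher_deriv_shift add.commute[of x])
  then show ?thesis
    by (simp add: wflat_def weyl_apply_sum weyl_apply_def[of T] higher_deriv_shift add.commute[of x])
qed

section \<open>Independent entire functions annihilated by an operator\<close>

lemma weyl_apply_zero_fun [simp]: "weyl_apply A (\<lambda>_. 0) x = 0"
  using weyl_apply_lincomb[of "{}" "\<lambda>_ _. 0" A] by simp

text \<open>Composing T with powers of \<partial> keeps its leading coefficient, which can be
  divided by at \<open>x0\<close>. Thus each derivative at \<open>x0\<close> of order at least
  \<open>degree T\<close> is determined by the lower ones, and the whole Taylor series
  vanishes.\<close>

lemma annihilated_entire_eq_0:
  assumes u: "u holomorphic_on UNIV" and T: "poly (lead_coeff T) x0 \<noteq> 0"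
    and Tu: "\<And>x. weyl_apply T u x = 0" and init: "\<And>l. l < degree T \<Longrightarrow> (deriv ^^ l) u x0 = 0"
  shows "u x = 0"
proof -
  have "(deriv ^^ m) u x0 = 0" for m
  proof (induction m rule: less_induct)
    case (less m)
    show ?case
    proof (cases "m < degree T")
      case False
      define i where "i = m - degree T"
      with False have m: "m = degree T + i" by simp
      have Tu': "weyl_apply T u = (\<lambda>_. 0)"
        using Tu by auto
      have "weyl_apply ((W.dd ^^ i) T) u x0 = 0"
        unfolding W.dmult_monom1[symmetric] by (simp add: weyl_apply_wmult[OF u] Tu')
      moreover have "degree ((W.dd ^^ i) T) \<le> m"
        using W.degree_ddpow_le[of i T] by (simp add: m)
      ultimately have "(\<Sum>k\<le>m. poly (coeff ((W.dd ^^ i) T) k) x0 * (deriv ^^ k) u x0) = 0"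
        by (simp add: weyl_apply_bound)
      moreover have "(\<Sum>k\<le>m. poly (coeff ((W.dd ^^ i) T) k) x0 * (deriv ^^ k) u x0)
          = (\<Sum>k\<le>m. if k = m then poly (lead_coeff T) x0 * (deriv ^^ m) u x0 else 0)"
        using less W.coeff_ddpow_top[of i T] by (intro sum.cong) (auto simp: m)
      ultimately show ?thesis
        using T by simp
    qed (rule init)
  qed
  then show ?thesis
    using holomorphic_fun_eq_0_on_connected[OF u, of x0 x] connected_UNIV by simp
qed

definition indep_funs :: "'i set \<Rightarrow> ('i \<Rightarrow> complex \<Rightarrow> complex) \<Rightarrow> bool" where
  "indep_funs S u \<longleftrightarrow> (\<forall>c. (\<forall>x. (\<Sum>s\<in>S. c s * u s x) = 0) \<longrightarrow> (\<forall>s\<in>S. c s = 0))"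

lemma indep_funs_mono:
  assumes "indep_funs S u" "S' \<subseteq> S" "finite S"
  shows "indep_funs S' u"
  unfolding indep_funs_def
proof safe
  fix c s assume c: "\<forall>x. (\<Sum>s\<in>S'. c s * u s x) = 0" and s: "s \<in> S'"
  let ?c = "\<lambda>s. if s \<in> S' then c s else 0"
  have "(\<Sum>s\<in>S. ?c s * u s x) = (\<Sum>s\<in>S'. c s * u s x)" for x
    using assms by (intro sum.mono_neutral_cong_right) auto
  with c have "\<forall>x. (\<Sum>s\<in>S. ?c s * u s x) = 0"
    by simp
  with assms(1) have "\<forall>s\<in>S. ?c s = 0"
    unfolding indep_funs_def by (elim allE[of _ ?c]) simp
  with s assms(2) have "?c s = 0"
    by blast
  with s show "c s = 0"
    by simp
qed

lemma vec_0_iff: "v \<in> carrier_vec n \<Longrightarrow> v = 0\<^sub>v n \<longleftrightarrow> (\<forall>k<n. vec_index v k = 0)"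
  by (auto simp: Matrix.vec_eq_iff)

lemma mat_mult_vec_index:
  assumes "A \<in> carrier_mat m n" "v \<in> carrier_vec n" "i < m"
  shows "vec_index (A *\<^sub>v v) i = (\<Sum>j<n. A $$ (i, j) * vec_index v j)"
  using assms by (auto simp: scalar_prod_def lessThan_atLeast0 intro!: sum.cong)

text \<open>Among more than \<open>degree T\<close> functions some nontrivial combination has
  vanishing initial data up to order \<open>degree T\<close> at a point where the leading
  coefficient is nonzero, and hence vanishes identically.\<close>

lemma card_indep_annihilated_le:
  fixes u :: "'i \<Rightarrow> complex \<Rightarrow> complex"
  assumes S: "finite S" and ind: "indep_funs S u"
    and u: "\<And>s. s \<in> S \<Longrightarrow> u s holomorphic_on UNIV"
    and T: "T \<noteq> 0" and Tu: "\<And>s x. s \<in> S \<Longrightarrow> weyl_apply T (u s) x = 0"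
  shows "card S \<le> degree T"
proof (rule ccontr)
  define N where "N = card S"
  assume "\<not> ?thesis"
  then have dT: "degree T < N" by (simp add: N_def)
  have "finite {x. poly (lead_coeff T) x = 0}"
    using T by (intro poly_roots_finite) simp
  then have "{x. poly (lead_coeff T) x = 0} \<noteq> (UNIV :: complex set)"
    using infinite_UNIV_char_0 by metis
  then obtain x0 where x0: "poly (lead_coeff T) x0 \<noteq> 0"
    by auto
  obtain e where e: "bij_betw e {..<N} S"
    using ex_bij_betw_nat_finite[OF S] by (auto simp: N_def lessThan_atLeast0)
  \<comment> \<open>The conditions number fewer than \<open>N\<close>, so the matrix is made square
    by zero rows; the zero row at index \<open>degree T\<close> forces the determinant to vanish and
    supplies a null vector.\<close>
  define A where
    "A = Matrix.mat N N (\<lambda>(l, k). if l < degree T then (deriv ^^ l) (u (e k)) x0 else 0)"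
  have A: "A \<in> carrier_mat N N"
    by (simp add: A_def)
  have "Determinant.det A = (\<Sum>j<N. A $$ (degree T, j) * cofactor A (degree T) j)"
    by (rule laplace_expansion_row[OF A dT])
  also have "\<dots> = 0"
    using dT by (intro sum.neutral) (auto simp: A_def)
  finally have "\<exists>v :: complex Matrix.vec. v \<in> carrier_vec N \<and> v \<noteq> 0\<^sub>v N \<and> A *\<^sub>v v = 0\<^sub>v N"
    using det_0_iff_vec_prod_zero[OF A] by simp
  then obtain v :: "complex Matrix.vec" where v: "v \<in> carrier_vec N" "v \<noteq> 0\<^sub>v N" "A *\<^sub>v v = 0\<^sub>v N"
    by blast
  define c where "c = (\<lambda>s. vec_index v (the_inv_into {..<N} e s))"
  have ce: "c (e k) = vec_index v k" if "k < N" for k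
    using that e by (simp add: c_def the_inv_into_f_f bij_betw_def)
  define w where "w = (\<lambda>x. \<Sum>s\<in>S. c s * u s x)"
  have "w x = 0" for x
  proof (rule annihilated_entire_eq_0[where u = w, OF _ x0])
    show "w holomorphic_on UNIV"
      unfolding w_def using u by (intro holomorphic_intros) auto
    show "weyl_apply T w x = 0" for x
      unfolding w_def by (subst weyl_apply_lincomb) (simp_all add: u Tu)
    show "(deriv ^^ l) w x0 = 0" if l: "l < degree T" for l
    proof -
      have "(deriv ^^ l) w x0 = (\<Sum>s\<in>S. c s * (deriv ^^ l) (u s) x0)"
        unfolding w_def by (rule higher_deriv_sum) (rule u)
      also have "\<dots> = (\<Sum>k<N. c (e k) * (deriv ^^ l) (u (e k)) x0)"
        by (rule sum.reindex_bij_betw[OF e, symmetric])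
      also have "\<dots> = (\<Sum>k<N. A $$ (l, k) * vec_index v k)"
        using l dT by (intro sum.cong) (auto simp: A_def ce)
      also have "\<dots> = vec_index (A *\<^sub>v v) l"
        using l dT by (intro mat_mult_vec_index[OF A v(1), symmetric]) simp
      finally show ?thesis
        using l dT v by simp
    qed
  qed
  with ind have "\<forall>s\<in>S. c s = 0"
    unfolding indep_funs_def w_def by blast
  then have "vec_index v k = 0" if "k < N" for k
    using ce[OF that] bij_betwE[OF e] that by auto
  with v show False
    using vec_0_iff by blast
qed

section \<open>Pseudo-division\<close>

text \<open>Multiplying by the leading coefficient of \<open>K\<close> replaces dividing by it.
  Quotient and remainder keep polynomial coefficients and can thus be applied to entire functions at
  every point.\<close>

lemma weyl_pseudo_division:
  assumes K: "degree K > 0"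
  obtains m Q R where "smult (lead_coeff K ^ m) T = wmult Q K + R" "degree R < degree K"
proof -
  have "\<exists>m Q R. smult (lead_coeff K ^ m) T = wmult Q K + R \<and> degree R < degree K"
    if "degree T < degree K + k" for k
    using that
  proof (induction k arbitrary: T)
    case 0
    then show ?case
      by (intro exI[of _ 0] exI[of _ T]) auto
  next
    case (Suc k)
    show ?case
    proof (cases "degree T < degree K + k")
      case True
      then show ?thesis by (rule Suc.IH)
    next
      case False
      with Suc.prems have dT: "degree T = degree K + k" by simp
      have K0: "K \<noteq> 0" using K by auto
      define M where "M = monom (lead_coeff T) k"
      define T' where "T' = smult (lead_coeff K) T - wmult M K"
      have "T \<noteq> 0" using dT K by auto
      then have M: "degree M = k" "lead_coeff M = lead_coeff T"
        by (simp_all add: M_def degree_monom_eq)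
      have "degree (wmult M K) \<le> degree K + k"
        using W.dmult_degree_le[of M K] M by simp
      moreover have "degree (smult (lead_coeff K) T) \<le> degree K + k"
        using degree_smult_le[of "lead_coeff K" T] dT by simp
      ultimately have "degree T' \<le> degree K + k"
        unfolding T'_def by (intro degree_diff_le)
      moreover have "coeff T' (degree K + k) = 0"
        using W.coeff_dmult_top[of M K] M dT by (simp add: T'_def add.commute mult.commute)
      ultimately have "degree T' < degree K + k"
        using K by (cases "T' = 0") (auto simp: le_less dest: leading_coeff_neq_0)
      then obtain m Q R where QR: "smult (lead_coeff K ^ m) T' = wmult Q K + R" "degree R < degree K"
        using Suc.IH by blast
      have "smult (lead_coeff K ^ Suc m) T
          = smult (lead_coeff K ^ m) T' + wmult (smult (lead_coeff K ^ m) M) K"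
        by (simp add: T'_def smult_diff_right W.dmult_smult_left mult.commute)
      also have "\<dots> = wmult (Q + smult (lead_coeff K ^ m) M) K + R"
        by (simp add: QR W.dmult_add_left)
      finally show ?thesis
        using QR(2) by blast
    qed
  qed
  from this[of "degree T"] show thesis
    using K that by auto
qed

lemma weyl_apply_plus:
  assumes "u holomorphic_on UNIV" "v holomorphic_on UNIV"
  shows "weyl_apply A (\<lambda>y. b * u y + c * v y) x = b * weyl_apply A u x + c * weyl_apply A v x"
  using weyl_apply_lincomb[of UNIV "\<lambda>t. if t then u else v" A "\<lambda>t. if t then b else c" x] assms
  by (simp add: UNIV_bool add.commute)

lemma poly_double_root:
  fixes p :: "'a::idom poly"
  assumes "[:- l, 1:]\<^sup>2 dvd p"
  shows "poly p l = 0" "poly (pderiv p) l = 0"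
proof -
  from assms obtain q where "p = [:- l, 1:] * ([:- l, 1:] * q)"
    unfolding power2_eq_square mult.assoc[symmetric] by (metis dvdE mult.assoc)
  then show "poly p l = 0" "poly (pderiv p) l = 0"
    by (simp_all only: pderiv_mult poly_mult poly_add) simp_all
qed

lemma wr_det_eq_det:
  "wr_det vs x = Determinant.det
     (Matrix.mat (length vs) (length vs) (\<lambda>(i, j). (deriv ^^ i) (vs ! j) x))"
proof -
  have "(\<Prod>i<length vs. (deriv ^^ i) (vs ! \<sigma> i) x)
      = (\<Prod>i = 0..<length vs. Matrix.mat (length vs) (length vs) (\<lambda>(i, j). (deriv ^^ i) (vs ! j) x) $$ (i, \<sigma> i))"
    if "\<sigma> permutes {0..<length vs}" for \<sigma>
    using permutes_in_image[OF that] by (simp add: lessThan_atLeast0)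
  then show ?thesis
    unfolding wr_det_def Determinant.det_def Let_def by (simp add: lessThan_atLeast0)
qed

section \<open>The functions spanning the kernel\<close>

locale airy =
  fixes r n :: nat and a :: "nat \<Rightarrow> complex" and f :: "nat \<Rightarrow> complex \<Rightarrow> complex"
    and lam gam :: "nat \<Rightarrow> complex"
  assumes r: "r > 1"
    and f_ker: "\<And>j. j < r \<Longrightarrow> in_ker (L0 r a) (f j)"
    and f_wr: "\<And>x. wr_det (map f [0..<r]) x = 1"
    and n: "n \<ge> 1"
    and lam: "inj_on lam {..<n}"
begin

lemma f_indep:
  assumes c: "\<And>x. (\<Sum>j<r. c j * f j x) = 0" and "j < r"
  shows "c j = 0"
proof -
  define A where "A = Matrix.mat r r (\<lambda>(i, j). (deriv ^^ i) (f j) 0)"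
  have A: "A \<in> carrier_mat r r" by (simp add: A_def)
  have "Determinant.det A = wr_det (map f [0..<r]) 0"
    unfolding wr_det_eq_det A_def by (intro arg_cong[where f = Determinant.det] cong_mat) auto
  then have det: "Determinant.det A \<noteq> 0"
    using f_wr by simp
  have "A *\<^sub>v Matrix.vec r c = 0\<^sub>v r"
  proof (rule Matrix.eq_vecI)
    fix l assume "l < dim_vec (0\<^sub>v r :: complex Matrix.vec)"
    then have l: "l < r" by simp
    have "vec_index (A *\<^sub>v Matrix.vec r c) l = (\<Sum>j<r. c j * (deriv ^^ l) (f j) 0)"
      using l by (subst mat_mult_vec_index[OF A]) (auto simp: A_def intro!: sum.cong)
    also have "\<dots> = (deriv ^^ l) (\<lambda>y. \<Sum>j<r. c j * f j y) 0"
      by (rule higher_deriv_sum[symmetric]) (use in_kerD(1)[OF f_ker] in auto)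
    also have "\<dots> = 0"
      by (simp add: c higher_deriv_const[of 0, simplified])
    finally show "vec_index (A *\<^sub>v Matrix.vec r c) l = vec_index (0\<^sub>v r) l"
      using l by simp
  qed (simp add: A_def)
  with det det_0_iff_vec_prod_zero[OF A] have "Matrix.vec r c = 0\<^sub>v r"
    by (metis vec_carrier)
  with \<open>j < r\<close> show ?thesis
    by (metis index_vec index_zero_vec(1))
qed

text \<open>The flag separates the eigenfunctions f_j(x + lam_i) (\<open>True\<close>) from the
  functions phi_ij (\<open>False\<close>). One family holds both, so independence is proved once and
  then restricted to the subfamily at hand.\<close>

definition Phi :: "nat \<times> nat \<times> bool \<Rightarrow> complex \<Rightarrow> complex" where
  "Phi = (\<lambda>(i, j, b) x. if b then f j (x + lam i) else deriv (f j) (x + lam i) + gam i * f j (x + lam i))"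

lemma Phi_holomorphic:
  assumes "j < r"
  shows "Phi (i, j, b) holomorphic_on UNIV"
proof -
  have f: "f j holomorphic_on UNIV"
    using f_ker[OF assms] by (rule in_kerD)
  show ?thesis
    using holomorphic_shift[OF f, of "lam i"] holomorphic_shift[OF holomorphic_deriv[OF f], of "lam i"]
    by (cases b) (auto simp: Phi_def intro!: holomorphic_intros)
qed

lemma weval_Phi:
  assumes j: "j < r"
  shows "weyl_apply (weval (L0 r a) p) (Phi (i, j, b)) x
     = poly p (lam i) * Phi (i, j, b) x + (if b then 0 else poly (pderiv p) (lam i) * Phi (i, j, True) x)"
proof (cases b)
  case True
  then show ?thesis
    using weval_L0_shift[OF f_ker[OF j], of p "lam i" x] by (simp add: Phi_def)
next
  case False
  have f: "f j holomorphic_on UNIV"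
    using f_ker[OF j] by (rule in_kerD)
  have "weyl_apply (weval (L0 r a) p) (\<lambda>x. 1 * deriv (f j) (x + lam i) + gam i * f j (x + lam i)) x
      = 1 * weyl_apply (weval (L0 r a) p) (\<lambda>x. deriv (f j) (x + lam i)) x
        + gam i * weyl_apply (weval (L0 r a) p) (\<lambda>x. f j (x + lam i)) x"
    using holomorphic_shift[OF f] holomorphic_shift[OF holomorphic_deriv[OF f]]
    by (intro weyl_apply_plus) auto
  then show ?thesis
    using False
    by (simp add: Phi_def weval_L0_shift[OF f_ker[OF j]] weval_L0_deriv_shift[OF f_ker[OF j]] algebra_simps)
qed

text \<open>Double zeros are required because p(L0) acts on the block of lam_k through both p(lam_k)
  and p'(lam_k); such a polynomial erases every block except block \<open>i\<close>.\<close>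

lemma double_root_poly:
  assumes i: "i < n"
  obtains q where "poly q (lam i) \<noteq> 0"
    and "\<And>k. k < n \<Longrightarrow> k \<noteq> i \<Longrightarrow> [:- lam k, 1:]\<^sup>2 dvd q"
proof
  let ?q = "\<Prod>k\<in>{..<n} - {i}. [:- lam k, 1:]\<^sup>2"
  show "poly ?q (lam i) \<noteq> 0"
    using lam i by (auto simp: poly_prod inj_on_def)
  show "[:- lam k, 1:]\<^sup>2 dvd ?q" if "k < n" "k \<noteq> i" for k
    using that by (intro dvd_prodI) auto
qed

text \<open>After the other blocks are erased, two choices of p isolate the two kinds of
  coefficients in block \<open>i\<close>, and the nonvanishing Wronskian of the f_j
  finishes.\<close>

lemma Phi_indep: "indep_funs ({..<n} \<times> {..<r} \<times> UNIV) Phi"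
  unfolding indep_funs_def
proof (intro allI impI)
  fix c :: "nat \<times> nat \<times> bool \<Rightarrow> complex"
  let ?S = "{..<n} \<times> {..<r} \<times> (UNIV :: bool set)"
  assume c: "\<forall>x. (\<Sum>s\<in>?S. c s * Phi s x) = 0"
  have *: "(\<Sum>j<r. c (i, j, False) * (poly p (lam i) * Phi (i, j, False) x + poly (pderiv p) (lam i) * Phi (i, j, True) x)
        + c (i, j, True) * (poly p (lam i) * Phi (i, j, True) x)) = 0"
    if i: "i < n" and p: "\<And>k. k < n \<Longrightarrow> k \<noteq> i \<Longrightarrow> [:- lam k, 1:]\<^sup>2 dvd p" for i p x
  proof -
    have z: "poly p (lam k) = 0" "poly (pderiv p) (lam k) = 0" if "k < n" "k \<noteq> i" for k
      using poly_double_root[OF p[OF that]] by simp_all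
    have w0: "weyl_apply (weval (L0 r a) p) (Phi (k, j, b)) x = 0" if "k < n" "k \<noteq> i" "j < r" for k j b
      using that by (simp add: weval_Phi z)
    have "0 = weyl_apply (weval (L0 r a) p) (\<lambda>x. \<Sum>s\<in>?S. c s * Phi s x) x"
      using c by simp
    also have "\<dots> = (\<Sum>s\<in>?S. c s * weyl_apply (weval (L0 r a) p) (Phi s) x)"
      by (rule weyl_apply_lincomb) (auto intro: Phi_holomorphic)
    also have "\<dots> = (\<Sum>s\<in>{i} \<times> {..<r} \<times> UNIV. c s * weyl_apply (weval (L0 r a) p) (Phi s) x)"
      using i w0 by (intro sum.mono_neutral_right) auto
    also have "\<dots> = (\<Sum>j<r. \<Sum>b\<in>UNIV. c (i, j, b) * weyl_apply (weval (L0 r a) p) (Phi (i, j, b)) x)"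
      by (simp add: sum.cartesian_product' del: UNIV_bool)
    finally show ?thesis
      by (simp add: UNIV_bool weval_Phi)
  qed
  have "c (i, j, b) = 0" if i: "i < n" and j: "j < r" for i j b
  proof -
    obtain q where q: "poly q (lam i) \<noteq> 0" "\<And>k. k < n \<Longrightarrow> k \<noteq> i \<Longrightarrow> [:- lam k, 1:]\<^sup>2 dvd q"
      using double_root_poly[OF i] by blast
    \<comment> \<open>A further simple zero at \<open>lam i\<close> removes the terms with p and
      leaves p'(lam i) = q(lam i), which multiplies exactly the coefficients with flag
      \<open>False\<close>.\<close>
    define p where "p = [:- lam i, 1:] * q"
    have q1: "poly p (lam i) = 0" "poly (pderiv p) (lam i) = poly q (lam i)"
      unfolding p_def by (simp_all only: pderiv_mult poly_mult poly_add) (simp_all add: pderiv_pCons)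
    have qp: "[:- lam k, 1:]\<^sup>2 dvd p" if "k < n" "k \<noteq> i" for k
      unfolding p_def by (intro dvd_mult q(2) that)
    have cF: "c (i, j, False) = 0" if "j < r" for j
    proof (rule f_indep[OF _ that])
      fix y
      have "(\<Sum>j<r. c (i, j, False) * (poly q (lam i) * f j y)) = 0"
        using *[OF i qp, of "y - lam i"] by (simp add: q1 Phi_def)
      then have "poly q (lam i) * (\<Sum>j<r. c (i, j, False) * f j y) = 0"
        by (simp add: sum_distrib_left mult.left_commute)
      then show "(\<Sum>j<r. c (i, j, False) * f j y) = 0"
        using q(1) by simp
    qed
    \<comment> \<open>Now \<open>q\<close> itself is used: the term with its derivative carries the
      coefficients just shown to be zero.\<close>
    have cT: "c (i, j, True) = 0"
    proof (rule f_indep[OF _ j])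
      fix y
      have "(\<Sum>j<r. c (i, j, True) * (poly q (lam i) * f j y)) = 0"
        using *[OF i q(2), of "y - lam i"] by (simp add: cF Phi_def)
      then have "poly q (lam i) * (\<Sum>j<r. c (i, j, True) * f j y) = 0"
        by (simp add: sum_distrib_left mult.left_commute)
      then show "(\<Sum>j<r. c (i, j, True) * f j y) = 0"
        using q(1) by simp
    qed
    show ?thesis
      using cF[OF j] cT by (cases b) auto
  qed
  then show "\<forall>s\<in>?S. c s = 0"
    by auto
qed

end

section \<open>The Wronskian as an operator with polynomial coefficients\<close>

lemma div_mod_block:
  fixes c k r :: nat
  assumes "k * r \<le> c" "c < k * r + r"
  shows "c div r = k" "c mod r = c - k * r"
proof -
  obtain m where "c = k * r + m" "m < r"
    using assms by (metis le_iff_add nat_add_left_cancel_less)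
  then show "c div r = k" "c mod r = c - k * r"
    by simp_all
qed

lemma sum_div_mod:
  assumes "(r::nat) > 0"
  shows "(\<Sum>c<n * r. F (c div r) (c mod r)) = (\<Sum>i<n. \<Sum>m<r. F i m)"
proof (induction n)
  case (Suc n)
  have "(\<Sum>c<Suc n * r. F (c div r) (c mod r)) = (\<Sum>c<n * r. F (c div r) (c mod r))
      + (\<Sum>c\<in>{n * r..<n * r + r}. F (c div r) (c mod r))"
    by (simp add: lessThan_atLeast0 sum.atLeastLessThan_concat add.commute)
  also have "(\<Sum>c\<in>{n * r..<n * r + r}. F (c div r) (c mod r)) = (\<Sum>m<r. F n m)"
    by (rule sum.reindex_bij_witness[of _ "\<lambda>m. n * r + m" "\<lambda>c. c - n * r"])
       (auto simp: div_mod_block)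
  finally show ?case by (simp add: Suc)
qed simp

lemma
  shows length_concat_map_map: "length (concat (map (\<lambda>i. map (g i) [0..<r]) [0..<n])) = n * r"
    and nth_concat_map_map: "k < n * r \<Longrightarrow>
      concat (map (\<lambda>i. map (g i) [0..<r]) [0..<n]) ! k = g (k div r) (k mod r)"
proof -
  show l: "length (concat (map (\<lambda>i. map (g i) [0..<r]) [0..<n])) = n * r" for n
    by (induction n) simp_all
  show "k < n * r \<Longrightarrow>
      concat (map (\<lambda>i. map (g i) [0..<r]) [0..<n]) ! k = g (k div r) (k mod r)"
  proof (induction n)
    case (Suc n)
    show ?case
    proof (cases "k < n * r")
      case False
      then have "k - n * r < r" "k div r = n" "k mod r = k - n * r"
        using Suc.prems div_mod_block[of n r k] by auto
      with False show ?thesis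
        by (simp add: nth_append l[unfolded length_concat] length_concat[symmetric] l)
    qed (use Suc in \<open>simp add: nth_append l\<close>)
  qed simp
qed

context airy
begin

abbreviation "N \<equiv> n * r"

lemma r_pos: "r > 0" and N_pos: "N > 0"
  using r n by auto

lemma div_mod_bounds: "c < N \<Longrightarrow> c div r < n \<and> c mod r < r"
  using r by (simp add: less_mult_imp_div_less)

lemma phis_eq:
  "length (phis r f n lam gam) = N"
  "c < N \<Longrightarrow> phis r f n lam gam ! c = Phi (c div r, c mod r, False)"
  by (simp_all add: phis_def length_concat_map_map nth_concat_map_map Phi_def)

lemma degree_L0: "degree (L0 r a) = r" and lead_coeff_L0: "lead_coeff (L0 r a) = 1"
proof -
  show "degree (L0 r a) = r"
  proof (rule antisym)
    show "degree (L0 r a) \<le> r"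
      using r by (intro degree_le) (auto simp: coeff_L0)
    show "r \<le> degree (L0 r a)"
      using r by (intro le_degree) (auto simp: coeff_L0)
  qed
  then show "lead_coeff (L0 r a) = 1"
    using r by (simp add: coeff_L0)
qed

text \<open>\<open>L0\<close> is monic, so pseudo-division multiplies by powers of 1 only. The same
  polynomials serve all kernel functions at once.\<close>

lemma higher_deriv_reduce:
  "\<exists>h. \<forall>u x. in_ker (L0 r a) u \<longrightarrow> (deriv ^^ l) u x = (\<Sum>m<r. poly (h m) x * (deriv ^^ m) u x)"
proof -
  from r_pos obtain m Q R where "smult (1 ^ m) (monom 1 l) = wmult Q (L0 r a) + R" "degree R < r"
    by (rule weyl_pseudo_division[of "L0 r a" "monom 1 l", unfolded lead_coeff_L0, unfolded degree_L0])
  then have QR: "monom 1 l = wmult Q (L0 r a) + R" "degree R < r"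
    by simp_all
  have "(deriv ^^ l) u x = (\<Sum>m<r. poly (coeff R m) x * (deriv ^^ m) u x)"
    if u: "in_ker (L0 r a) u" for u x
  proof -
    have "weyl_apply (L0 r a) u = (\<lambda>_. 0)"
      using in_kerD(2)[OF u] by auto
    then have "weyl_apply (monom 1 l) u x = weyl_apply R u x"
      by (simp add: QR weyl_apply_add weyl_apply_wmult[OF in_kerD(1)[OF u]])
    also have "\<dots> = (\<Sum>m\<le>r-1. poly (coeff R m) x * (deriv ^^ m) u x)"
      using QR(2) by (intro weyl_apply_bound) simp
    also have "{..r-1} = {..<r}"
      using r by auto
    finally show ?thesis
      by (simp add: weyl_apply_monom)
  qed
  then show ?thesis by blast
qed

text \<open>The essential point is that \<open>G\<close> is independent of \<open>j\<close>: the
  Wronskian matrix of the phi_ij then factors into a polynomial matrix and the matrices Wr(f)(x +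
  lam_i). Composition with x + lam_i accounts for the translated argument.\<close>

lemma higher_deriv_Phi:
  "\<exists>G. \<forall>l i j x. j < r \<longrightarrow>
     (deriv ^^ l) (Phi (i, j, False)) x = (\<Sum>m<r. poly (G l i m) x * (deriv ^^ m) (f j) (x + lam i))"
proof -
  obtain h where h: "\<And>l u x. in_ker (L0 r a) u \<Longrightarrow>
      (deriv ^^ l) u x = (\<Sum>m<r. poly (h l m) x * (deriv ^^ m) u x)"
    using choice[OF allI[where P = "\<lambda>l. \<exists>h. \<forall>u x. in_ker (L0 r a) u \<longrightarrow>
        (deriv ^^ l) u x = (\<Sum>m<r. poly (h m) x * (deriv ^^ m) u x)", OF higher_deriv_reduce]]
    by blast
  define G where "G = (\<lambda>l i m. pcompose (h (Suc l) m + smult (gam i) (h l m)) [:lam i, 1:])"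
  have "(deriv ^^ l) (Phi (i, j, False)) x = (\<Sum>m<r. poly (G l i m) x * (deriv ^^ m) (f j) (x + lam i))"
    if j: "j < r" for l i j x
  proof -
    have f: "f j holomorphic_on UNIV"
      using f_ker[OF j] by (rule in_kerD)
    have "weyl_apply (monom 1 l) (\<lambda>x. 1 * deriv (f j) (x + lam i) + gam i * f j (x + lam i)) x
      = 1 * weyl_apply (monom 1 l) (\<lambda>x. deriv (f j) (x + lam i)) x
        + gam i * weyl_apply (monom 1 l) (\<lambda>x. f j (x + lam i)) x"
      using holomorphic_shift[OF f] holomorphic_shift[OF holomorphic_deriv[OF f]]
      by (intro weyl_apply_plus) auto
    then have "(deriv ^^ l) (Phi (i, j, False)) x
        = (deriv ^^ Suc l) (f j) (x + lam i) + gam i * (deriv ^^ l) (f j) (x + lam i)"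
      by (simp add: weyl_apply_monom higher_deriv_shift Phi_def funpow_Suc_right del: funpow.simps)
    also have "\<dots> = (\<Sum>m<r. poly (G l i m) x * (deriv ^^ m) (f j) (x + lam i))"
      unfolding h[OF f_ker[OF j], of "Suc l"] h[OF f_ker[OF j], of l]
      by (simp add: G_def poly_pcompose sum_distrib_left sum.distrib ring_distribs mult.assoc add.commute)
    finally show ?thesis .
  qed
  then show ?thesis by blast
qed

text \<open>The block diagonal matrix with blocks Wr(f)(x + lam_i) for i < k. Leaving
  \<open>k\<close> free allows its determinant to be computed by adding one block at a time.\<close>

definition B_mat :: "nat \<Rightarrow> complex \<Rightarrow> complex mat" where
  "B_mat k x = Matrix.mat (k * r) (k * r) (\<lambda>(c, c'). if c div r = c' div r
     then (deriv ^^ (c mod r)) (f (c' mod r)) (x + lam (c div r)) else 0)"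

lemma det_B_mat: "Determinant.det (B_mat k x) = 1"
proof (induction k)
  case (Suc k)
  define Wr where "Wr = Matrix.mat r r (\<lambda>(l, j). (deriv ^^ l) (f j) (x + lam k))"
  have lt: "c div r < k" if "c < k * r" for c
    using that by (rule less_mult_imp_div_less)
  have ge: "c div r = k \<and> c mod r = c - k * r" if "\<not> c < k * r" "c < r + k * r" for c
    using div_mod_block[of k r c] that by auto
  have "B_mat (Suc k) x = four_block_mat (B_mat k x) (0\<^sub>m (k * r) r) (0\<^sub>m r (k * r)) Wr"
  proof (rule Matrix.eq_matI)
    fix c c'
    assume "c < dim_row (four_block_mat (B_mat k x) (0\<^sub>m (k * r) r) (0\<^sub>m r (k * r)) Wr)"
      "c' < dim_col (four_block_mat (B_mat k x) (0\<^sub>m (k * r) r) (0\<^sub>m r (k * r)) Wr)"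
    then have c: "c < r + k * r" "c' < r + k * r"
      by (simp_all add: B_mat_def Wr_def add.commute)
    then show "B_mat (Suc k) x $$ (c, c')
        = four_block_mat (B_mat k x) (0\<^sub>m (k * r) r) (0\<^sub>m r (k * r)) Wr $$ (c, c')"
      using lt[of c] lt[of c'] ge[of c] ge[of c']
      by (cases "c < k * r"; cases "c' < k * r") (simp_all add: B_mat_def Wr_def)
  qed (simp_all add: B_mat_def Wr_def)
  then have "Determinant.det (B_mat (Suc k) x) = Determinant.det (B_mat k x) * Determinant.det Wr"
    by (simp only:) (rule det_four_block_mat_lower_left_zero, auto simp: B_mat_def Wr_def)
  moreover have "Determinant.det Wr = wr_det (map f [0..<r]) (x + lam k)"
    unfolding wr_det_eq_det Wr_def by (intro arg_cong[where f = Determinant.det] cong_mat) auto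
  ultimately show ?case
    using Suc f_wr by simp
qed (simp add: B_mat_def)

lemma det_append_unit_block:
  fixes A :: "'a::idom mat"
  assumes "A \<in> carrier_mat m m"
  shows "Determinant.det (four_block_mat A (0\<^sub>m m 1) (0\<^sub>m 1 m) (1\<^sub>m 1)) = Determinant.det A"
  using assms by (subst det_four_block_mat_lower_left_zero) auto

text \<open>The Wronskian matrix is a polynomial matrix bordered by the derivatives of
  \<open>u\<close>, times a matrix of determinant 1. Expansion along the border gives polynomial
  coefficients, and the order bound for annihilators of the phi_ij keeps the top one from
  vanishing.\<close>

lemma wronskian_operator:
  "\<exists>w. w N \<noteq> 0 \<and> (\<forall>u x. wr_det (phis r f n lam gam @ [u]) x = (\<Sum>k\<le>N. poly (w k) x * (deriv ^^ k) u x))"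
proof -
  obtain G where G: "\<And>l i j x. j < r \<Longrightarrow>
     (deriv ^^ l) (Phi (i, j, False)) x = (\<Sum>m<r. poly (G l i m) x * (deriv ^^ m) (f j) (x + lam i))"
    using higher_deriv_Phi by blast
  \<comment> \<open>The zero column marks the place of the derivatives of \<open>u\<close>; the
    cofactors along it are the coefficients sought.\<close>
  define M where "M = Matrix.mat (Suc N) (Suc N) (\<lambda>(l, c). if c < N then G l (c div r) (c mod r) else 0)"
  have M: "M \<in> carrier_mat (Suc N) (Suc N)"
    by (simp add: M_def)
  define w where "w = (\<lambda>k. cofactor M k N)"
  have wr: "wr_det (phis r f n lam gam @ [u]) x = (\<Sum>k\<le>N. poly (w k) x * (deriv ^^ k) u x)" for u x
  proof -
    define A where "A = Matrix.mat (Suc N) (Suc N) (\<lambda>(l, c).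
        if c < N then (deriv ^^ l) (Phi (c div r, c mod r, False)) x else (deriv ^^ l) u x)"
    define M' where "M' = Matrix.mat (Suc N) (Suc N) (\<lambda>(l, c).
        if c < N then poly (G l (c div r) (c mod r)) x else (deriv ^^ l) u x)"
    \<comment> \<open>The additional unit block passes the column of \<open>u\<close> through the
      product unchanged.\<close>
    define B where "B = four_block_mat (B_mat n x) (0\<^sub>m N 1) (0\<^sub>m 1 N) (1\<^sub>m 1)"
    have M': "M' \<in> carrier_mat (Suc N) (Suc N)"
      by (simp add: M'_def)
    have Bn: "B_mat n x \<in> carrier_mat N N"
      by (simp add: B_mat_def)
    then have B: "B \<in> carrier_mat (Suc N) (Suc N)"
      unfolding B_def by auto
    have Bi: "B $$ (c, c') = (if c < N \<and> c' < N then B_mat n x $$ (c, c') else if c = c' then 1 else 0)"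
      if "c < Suc N" "c' < Suc N" for c c'
      using that Bn by (auto simp: B_def)
    have "A = M' * B"
    proof (rule Matrix.eq_matI)
      fix l c assume "l < dim_row (M' * B)" "c < dim_col (M' * B)"
      then have lc: "l < Suc N" "c < Suc N"
        using M' B by auto
      have "(M' * B) $$ (l, c) = (\<Sum>k<Suc N. M' $$ (l, k) * B $$ (k, c))"
        using lc M' B by (auto simp: scalar_prod_def lessThan_atLeast0 intro!: sum.cong)
      also have "\<dots> = A $$ (l, c)"
      proof (cases "c < N")
        case True
        define i j where "i = c div r" and "j = c mod r"
        have ij: "i < n" "j < r"
          using div_mod_bounds[OF True] by (simp_all add: i_def j_def)
        have "(\<Sum>k<Suc N. M' $$ (l, k) * B $$ (k, c)) = (\<Sum>k<N. M' $$ (l, k) * B $$ (k, c))"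
          using lc True by (simp add: Bi)
        also have "\<dots> = (\<Sum>k<N. (\<lambda>i' m. poly (G l i' m) x
            * (if i' = i then (deriv ^^ m) (f j) (x + lam i') else 0)) (k div r) (k mod r))"
          using lc True by (intro sum.cong) (auto simp: Bi M'_def B_mat_def i_def j_def)
        also have "\<dots> = (\<Sum>i'<n. \<Sum>m<r. poly (G l i' m) x * (if i' = i then (deriv ^^ m) (f j) (x + lam i') else 0))"
          by (rule sum_div_mod[OF r_pos])
        also have "\<dots> = (\<Sum>i'<n. if i' = i then \<Sum>m<r. poly (G l i m) x * (deriv ^^ m) (f j) (x + lam i) else 0)"
          by (intro sum.cong) auto
        also have "\<dots> = (\<Sum>m<r. poly (G l i m) x * (deriv ^^ m) (f j) (x + lam i))"
          using ij by simp
        also have "\<dots> = A $$ (l, c)"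
          using lc True G[OF ij(2)] by (simp add: A_def i_def j_def)
        finally show ?thesis .
      next
        case False
        with lc have "c = N" by simp
        have "(\<Sum>k<Suc N. M' $$ (l, k) * B $$ (k, c)) = (\<Sum>k<Suc N. if k = N then (deriv ^^ l) u x else 0)"
          using lc unfolding \<open>c = N\<close> by (intro sum.cong) (auto simp: Bi M'_def)
        then show ?thesis
          using lc \<open>c = N\<close> by (simp add: A_def)
      qed
      finally show "A $$ (l, c) = (M' * B) $$ (l, c)" by simp
    qed (use M' B in \<open>auto simp: A_def\<close>)
    then have "Determinant.det A = Determinant.det M' * Determinant.det B"
      using det_mult[OF M' B] by simp
    also have "Determinant.det B = 1"
      unfolding B_def using det_append_unit_block[OF Bn] by (simp add: det_B_mat)
    also have "Determinant.det M' * 1 = (\<Sum>k<Suc N. M' $$ (k, N) * cofactor M' k N)"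
      using laplace_expansion_column[OF M', of N] by simp
    also have "\<dots> = (\<Sum>k<Suc N. poly (w k) x * (deriv ^^ k) u x)"
    proof (rule sum.cong)
      fix k assume k: "k \<in> {..<Suc N}"
      \<comment> \<open>Evaluation at \<open>x\<close> is a ring homomorphism and therefore commutes
        with the minors of \<open>M\<close>.\<close>
      interpret ev: comm_ring_hom "\<lambda>p. poly p x"
        by unfold_locales auto
      have "mat_delete M' k N = map_mat (\<lambda>p. poly p x) (mat_delete M k N)"
        using k by (intro Matrix.eq_matI) (auto simp: mat_delete_def M_def M'_def)
      then have "cofactor M' k N = poly (w k) x"
        by (simp add: cofactor_def w_def)
      then show "M' $$ (k, N) * cofactor M' k N = poly (w k) x * (deriv ^^ k) u x"
        using k by (simp add: M'_def)
    qed simp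
    also have "{..<Suc N} = {..N}"
      by auto
    finally have "Determinant.det A = (\<Sum>k\<le>N. poly (w k) x * (deriv ^^ k) u x)" .
    moreover have "wr_det (phis r f n lam gam @ [u]) x = Determinant.det A"
      unfolding wr_det_eq_det A_def
      by (rule arg_cong[where f = Determinant.det], rule Matrix.eq_matI)
         (auto simp: phis_eq nth_append less_Suc_eq)
    ultimately show ?thesis by simp
  qed
  have "w N \<noteq> 0"
  proof
    assume w0: "w N = 0"
    \<comment> \<open>A vanishing minor makes its rows dependent over the polynomials. Rows
      correspond to orders of differentiation, so a null vector of the transpose is the coefficient
      list of an operator of order below \<open>N\<close> that annihilates all phi_ij.\<close>
    define D where "D = transpose_mat (mat_delete M N N)"
    have Dc: "mat_delete M N N \<in> carrier_mat N N"
      using mat_delete_carrier[OF M] by simp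
    then have D: "D \<in> carrier_mat N N"
      by (simp add: D_def)
    have "Determinant.det D = 0"
      using w0 det_transpose[OF Dc] by (simp add: D_def w_def cofactor_def)
    then obtain v where v: "v \<in> carrier_vec N" "v \<noteq> 0\<^sub>v N" "D *\<^sub>v v = 0\<^sub>v N"
      using det_0_iff_vec_prod_zero[OF D] by auto
    define T where "T = (\<Sum>l<N. monom (vec_index v l) l)"
    have cT: "coeff T l = (if l < N then vec_index v l else 0)" for l
      by (simp add: T_def coeff_sum)
    have "T \<noteq> 0"
    proof
      assume "T = 0"
      then have "\<forall>l<N. vec_index v l = 0"
        using cT by (metis coeff_0)
      with v show False
        using vec_0_iff[OF v(1)] by blast
    qed
    have "degree T < N"
    proof -
      have "degree T \<le> N - 1"
        using N_pos by (intro degree_le) (auto simp: cT)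
      then show ?thesis using N_pos by linarith
    qed
    let ?S = "{..<n} \<times> {..<r} \<times> {False}"
    have "card ?S \<le> degree T"
    proof (rule card_indep_annihilated_le)
      show "indep_funs ?S Phi"
        by (rule indep_funs_mono[OF Phi_indep]) auto
      fix s x assume "s \<in> ?S"
      then obtain i j where s: "s = (i, j, False)" "i < n" "j < r"
        by auto
      have vD: "(\<Sum>l<N. vec_index v l * G l i m) = 0" if m: "m < r" for m
      proof -
        have c: "i * r + m < N" "(i * r + m) div r = i" "(i * r + m) mod r = m"
        proof -
          have "i * r + m < Suc i * r" using m by simp
          also have "\<dots> \<le> n * r" using s(2) by (intro mult_le_mono1) simp
          finally show "i * r + m < N" .
        qed (use m in auto)
        have "0 = vec_index (D *\<^sub>v v) (i * r + m)"
          using v c by simp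
        also have "\<dots> = (\<Sum>l<N. D $$ (i * r + m, l) * vec_index v l)"
          by (rule mat_mult_vec_index[OF D v(1) c(1)])
        also have "\<dots> = (\<Sum>l<N. vec_index v l * G l i m)"
          using c Dc by (intro sum.cong) (auto simp: D_def mat_delete_def M_def)
        finally show ?thesis by simp
      qed
      have "weyl_apply T (Phi s) x
          = (\<Sum>l<N. \<Sum>m<r. poly (vec_index v l) x * (poly (G l i m) x * (deriv ^^ m) (f j) (x + lam i)))"
        by (simp add: T_def weyl_apply_sum weyl_apply_monom s(1) G[OF s(3)] sum_distrib_left)
      also have "\<dots> = (\<Sum>m<r. \<Sum>l<N. poly (vec_index v l) x * (poly (G l i m) x * (deriv ^^ m) (f j) (x + lam i)))"
        by (rule sum.swap)
      also have "\<dots> = (\<Sum>m<r. poly (\<Sum>l<N. vec_index v l * G l i m) x * (deriv ^^ m) (f j) (x + lam i))"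
        by (simp add: poly_sum sum_distrib_right mult.assoc)
      also have "\<dots> = 0"
        by (simp add: vD)
      finally show "weyl_apply T (Phi s) x = 0" .
    qed (use \<open>T \<noteq> 0\<close> in \<open>auto intro: Phi_holomorphic\<close>)
    with \<open>degree T < N\<close> show False
      by simp
  qed
  with wr show ?thesis by blast
qed

section \<open>The operator K and the functions it annihilates\<close>

abbreviation "K \<equiv> Kbar r f n lam gam"

text \<open>\<open>Kbar\<close> is given by \<open>SOME\<close>, so an operator with the required
  properties has to be exhibited before any of them may be used.\<close>

lemma
  shows degree_K: "degree K = N"
    and K_Phi: "i < n \<Longrightarrow> j < r \<Longrightarrow> weyl_apply K (Phi (i, j, False)) x = 0"
proof -
  let ?P = "\<lambda>W. degree W = r * n \<and> lead_coeff (lead_coeff W) = 1 \<and>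
      (\<exists>\<kappa>. \<kappa> \<noteq> 0 \<and> (\<forall>u. u holomorphic_on UNIV \<longrightarrow>
          (\<forall>x. weyl_apply W u x = \<kappa> * wr_det (phis r f n lam gam @ [u]) x)))"
  obtain w where w: "w N \<noteq> 0"
    "\<And>u x. wr_det (phis r f n lam gam @ [u]) x = (\<Sum>k\<le>N. poly (w k) x * (deriv ^^ k) u x)"
    using wronskian_operator by blast
  \<comment> \<open>This factor makes the leading coefficient \<open>w N\<close> a monic
    polynomial.\<close>
  define \<kappa> where "\<kappa> = inverse (lead_coeff (w N))"
  have \<kappa>: "\<kappa> \<noteq> 0"
    using w by (simp add: \<kappa>_def)
  define W where "W = (\<Sum>k\<le>N. monom (smult \<kappa> (w k)) k)"
  have cW: "coeff W k = (if k \<le> N then smult \<kappa> (w k) else 0)" for k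
    by (simp add: W_def coeff_sum)
  have dW: "degree W = N"
    using w(1) \<kappa> by (intro antisym degree_le le_degree) (auto simp: cW)
  have "?P W"
  proof (intro conjI exI[of _ \<kappa>] allI impI \<kappa>)
    show "degree W = r * n"
      by (simp add: dW)
    show "lead_coeff (lead_coeff W) = 1"
      using w(1) \<kappa> by (simp add: dW cW) (simp add: \<kappa>_def)
    show "weyl_apply W u x = \<kappa> * wr_det (phis r f n lam gam @ [u]) x" for u x
      by (simp add: W_def weyl_apply_sum weyl_apply_monom w(2) sum_distrib_left mult.assoc)
  qed
  then have K: "?P K"
    unfolding Kbar_def by (rule someI)
  then show "degree K = N"
    by (simp add: mult.commute)
  assume ij: "i < n" "j < r"
  let ?vs = "phis r f n lam gam @ [Phi (i, j, False)]"
  define c where "c = i * r + j"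
  have "c < Suc i * r" using ij by (simp add: c_def)
  also have "\<dots> \<le> n * r" using ij by (intro mult_le_mono1) simp
  finally have c: "c < N" "c div r = i" "c mod r = j"
    using ij by (auto simp: c_def)
  \<comment> \<open>The appended function already stands in column \<open>c\<close>, so two columns
    of the Wronskian matrix coincide.\<close>
  have "wr_det ?vs x = 0"
    unfolding wr_det_eq_det
  proof (rule det_identical_columns[where n = "Suc N" and i = c and j = N])
    show "col (Matrix.mat (length ?vs) (length ?vs) (\<lambda>(i, j). (deriv ^^ i) (?vs ! j) x)) c
        = col (Matrix.mat (length ?vs) (length ?vs) (\<lambda>(i, j). (deriv ^^ i) (?vs ! j) x)) N"
      using c by (intro Matrix.eq_vecI) (auto simp: phis_eq nth_append)
  qed (use c in \<open>auto simp: phis_eq\<close>)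
  moreover from K obtain \<kappa> where
    "\<forall>u. u holomorphic_on UNIV \<longrightarrow> (\<forall>x. weyl_apply K u x = \<kappa> * wr_det (phis r f n lam gam @ [u]) x)"
    by blast
  ultimately show "weyl_apply K (Phi (i, j, False)) x = 0"
    using Phi_holomorphic[OF ij(2), of i] by simp
qed

end

section \<open>Conjugation by normalized operators\<close>

lemma clear_denominators:
  obtains s W where "s \<noteq> 0" "smult (Fract s 1) Q = embed W"
proof -
  have "\<exists>s W. s \<noteq> 0 \<and> smult (Fract s 1) Q = embed W"
  proof (induction Q)
    case 0
    show ?case
      by (intro exI[of _ 1] exI[of _ 0]) simp
  next
    case (pCons q Q)
    then obtain s W where s: "s \<noteq> 0" "smult (Fract s 1) Q = embed W"
      by blast
    obtain b c where q: "q = Fract b c" "c \<noteq> 0"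
      by (rule Fract_cases)
    have "smult (Fract (c * s) 1) (pCons q Q) = embed (pCons (b * s) (smult c W))"
    proof (rule poly_eqI)
      fix i
      have "Fract s 1 * coeff Q j = Fract (coeff W j) 1" for j
        using arg_cong[OF s(2), of "\<lambda>T. coeff T j"] by simp
      then have "Fract c 1 * (Fract s 1 * coeff Q j) = Fract (c * coeff W j) 1" for j
        by simp
      then show "coeff (smult (Fract (c * s) 1) (pCons q Q)) i = coeff (embed (pCons (b * s) (smult c W))) i"
        using q by (cases i) (simp_all add: eq_fract mult.assoc[symmetric])
    qed
    moreover have "c * s \<noteq> 0"
      using q s by simp
    ultimately show ?case by blast
  qed
  with that show thesis by blast
qed

lemma Fract_inverse: "s \<noteq> 0 \<Longrightarrow> Fract 1 s * Fract s 1 = 1" "s \<noteq> 0 \<Longrightarrow> Fract s 1 * Fract 1 s = 1"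
  by (simp_all add: One_fract_def eq_fract)

text \<open>The common form of K_C and of the normalized K^flat, which lets one eigenfunction lemma
  serve both spectral variables.\<close>

definition nrm :: "weyl \<Rightarrow> dop" where
  "nrm T = smult (Fract 1 (lead_coeff T)) (embed T)"

lemma nrm_nonzero: "T \<noteq> 0 \<Longrightarrow> nrm T \<noteq> 0"
  by (simp add: nrm_def Zero_fract_def eq_fract)

lemma conjD_eqI: "T \<noteq> 0 \<Longrightarrow> Dmult Q T = Dmult T S \<Longrightarrow> conjD T S = Q"
  unfolding conjD_def by (rule the_equality) (auto intro: R.dmult_cancel_right)

text \<open>With t the leading coefficient, T p(L) = Q T becomes (t^-1 Q t)(t^-1 T) = (t^-1 T) p(L),
  where t acts as an operator of order zero.\<close>

lemma Rset_nrm: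
  assumes T: "T \<noteq> 0" and p: "p \<in> Rset T L"
  shows "\<exists>Q. Dmult Q (nrm T) = Dmult (nrm T) (embed (weval L p))"
proof -
  let ?t = "lead_coeff T"
  obtain Q where Q: "embed (wmult T (weval L p)) = Dmult Q (embed T)"
    using p by (auto simp: Rset_def)
  have "Dmult (Dmult (smult (Fract 1 ?t) Q) [:Fract ?t 1:]) (nrm T) = smult (Fract 1 ?t) (Dmult Q (embed T))"
    using T by (simp add: nrm_def R.dmult_assoc R.dmult_const_left R.dmult_smult_left
        Fract_inverse del: mult_fract)
  also have "\<dots> = Dmult (nrm T) (embed (weval L p))"
    by (simp add: nrm_def R.dmult_smult_left embed_wmult flip: Q)
  finally show ?thesis by blast
qed

lemma conjD_nrm:
  assumes "T \<noteq> 0" "p \<in> Rset T L"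
  shows "Dmult (conjD (nrm T) (embed (weval L p))) (nrm T) = Dmult (nrm T) (embed (weval L p))"
  using Rset_nrm[OF assms] conjD_eqI[OF nrm_nonzero[OF assms(1)]] by metis

lemma D_nrm:
  assumes "poly (lead_coeff T) x \<noteq> 0"
  shows "D_defined_at (nrm T) x" "D_apply (nrm T) u x = weyl_apply T u x / poly (lead_coeff T) x"
  using assms
  by (simp_all add: nrm_def D_defined_at_smult rdefined_Fract D_apply_smult D_apply_embed)

text \<open>If Q T = T S and v is an eigenfunction of S, then T v is one of Q for the same
  eigenvalue. The number \<open>c\<close> stands for the normalizing factor in the other variable,
  which is constant for the variable of differentiation.\<close>

lemma conjD_eigenfunction:
  assumes T: "T \<noteq> 0" "p \<in> Rset T L"
    and u: "u holomorphic_on UNIV" "\<And>x. weyl_apply L u x = s * u x"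
    and x: "poly (lead_coeff T) x \<noteq> 0" "D_defined_at (conjD (nrm T) (embed (weval L p))) x"
  shows "D_apply (conjD (nrm T) (embed (weval L p)))
      (\<lambda>y. weyl_apply T u y / (poly (lead_coeff T) y * c)) x
    = poly p s * (weyl_apply T u x / (poly (lead_coeff T) x * c))"
proof -
  let ?Q = "conjD (nrm T) (embed (weval L p))"
  define v where "v = (\<lambda>y. inverse c * u y)"
  have v: "v holomorphic_on UNIV"
    unfolding v_def by (intro holomorphic_intros u)
  have Tv: "weyl_apply T v y = inverse c * weyl_apply T u y" for y
    unfolding v_def by (rule weyl_apply_cmult[OF u(1)])
  have Lv: "weyl_apply L v y = s * v y" for y
    unfolding v_def by (simp add: weyl_apply_cmult[OF u(1)] u(2))
  have pv: "weyl_apply (weval L p) v = (\<lambda>y. poly p s * v y)"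
    using weyl_apply_weval_eigen[OF v Lv] by blast
  \<comment> \<open>The quotient agrees with \<open>nrm T\<close> applied to \<open>v\<close> only
    off the zeros of the leading coefficient, an open set; the action of an operator at
    \<open>x\<close> is local, so this suffices.\<close>
  have "open {y. poly (lead_coeff T) y \<noteq> 0}"
    by (intro open_Collect_neq continuous_intros)
  then have "D_apply ?Q (\<lambda>y. weyl_apply T u y / (poly (lead_coeff T) y * c)) x
      = D_apply ?Q (D_apply (nrm T) v) x"
    by (rule D_apply_cong) (use x in \<open>auto simp: D_nrm Tv field_simps\<close>)
  also have "\<dots> = D_apply (Dmult ?Q (nrm T)) v x"
    by (rule D_apply_Dmult[symmetric, OF open_UNIV v UNIV_I x(2) D_nrm(1)[OF x(1)]])
  also have "\<dots> = D_apply (Dmult (nrm T) (embed (weval L p))) v x"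
    by (simp add: conjD_nrm[OF T])
  also have "\<dots> = D_apply (nrm T) (weyl_apply (weval L p) v) x"
    by (simp add: D_apply_Dmult[OF open_UNIV v UNIV_I D_nrm(1)[OF x(1)]] D_apply_embed)
  also have "\<dots> = poly p s * (weyl_apply T u x / (poly (lead_coeff T) x * c))"
    using x(1) by (simp only: D_nrm(2) pv weyl_apply_cmult[OF v] Tv not_False_eq_True) (simp add: field_simps)
  finally show ?thesis .
qed

section \<open>Common right denominators\<close>

text \<open>Each \<partial> costs at most one factor s, since the derivative of s^(k+1) is divisible
  by s^k.\<close>

lemma power_dvd_ddpow: "[:s ^ (m - i):] dvd (W.dd ^^ i) [:s ^ m:]"
proof (induction i)
  case (Suc i)
  show ?case
  proof (cases "i < m")
    case True
    then obtain k where k: "m - i = Suc k" "m - Suc i = k"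
      by (metis Suc_diff_Suc)
    with Suc obtain Y where Y: "(W.dd ^^ i) [:s ^ m:] = smult (s ^ Suc k) Y"
      by (auto elim: dvdE)
    have "(W.dd ^^ Suc i) [:s ^ m:] = smult (s ^ k) (smult (of_nat (Suc k) * pderiv s) Y + smult s (W.dd Y))"
      unfolding funpow.simps o_def Y W.dd_smult pderiv_power_Suc
      by (simp add: smult_add_right mult.commute mult.left_commute of_nat_poly)
    then show ?thesis
      unfolding k by (simp add: dvd_def exI[of _ "smult (of_nat (Suc k) * pderiv s) Y + smult s (W.dd Y)"])
  qed (simp flip: one_pCons)
qed simp

text \<open>An operator of order \<open>degree A\<close> uses up at most \<open>degree A\<close> of
  the factors s, so one of them can be moved to its left. This is the Ore condition in explicit
  form.\<close>

lemma wmult_power_const: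
  obtains Y where "wmult A [:s ^ Suc (degree A):] = smult s Y"
proof -
  have "[:s:] dvd smult (coeff A i) ((W.dd ^^ i) [:s ^ Suc (degree A):])" if "i \<le> degree A" for i
  proof -
    have "[:s:] dvd [:s ^ (Suc (degree A) - i):]"
      using that by (simp add: Suc_diff_le)
    also have "\<dots> dvd (W.dd ^^ i) [:s ^ Suc (degree A):]"
      by (rule power_dvd_ddpow)
    finally show ?thesis
      by (rule dvd_smult)
  qed
  then have "[:s:] dvd wmult A [:s ^ Suc (degree A):]"
    unfolding W.dmult_dd by (intro dvd_sum) auto
  then show thesis
    using that by (auto elim!: dvdE)
qed

section \<open>The bispectral Darboux transformation\<close>

context airy
begin

lemma K_nonzero: "K \<noteq> 0"
  using degree_K N_pos by auto

text \<open>The pseudo-remainder also annihilates the N independent functions phi_ij but has order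
  below N, so it is zero.\<close>

lemma annihilator_K:
  assumes T: "\<And>i j x. i < n \<Longrightarrow> j < r \<Longrightarrow> weyl_apply T (Phi (i, j, False)) x = 0"
  obtains s Q where "s \<noteq> 0" "smult s T = wmult Q K"
proof -
  obtain m Q R where QR: "smult (lead_coeff K ^ m) T = wmult Q K + R" "degree R < degree K"
    using weyl_pseudo_division[of K T] degree_K N_pos by metis
  let ?S = "{..<n} \<times> {..<r} \<times> {False}"
  have "R = 0"
  proof (rule ccontr)
    assume "R \<noteq> 0"
    have "card ?S \<le> degree R"
    proof (rule card_indep_annihilated_le)
      show "indep_funs ?S Phi"
        by (rule indep_funs_mono[OF Phi_indep]) auto
      fix s x assume "s \<in> ?S"
      then obtain i j where s: "s = (i, j, False)" "i < n" "j < r"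
        by auto
      have "weyl_apply K (Phi s) = (\<lambda>_. 0)"
        using K_Phi s by auto
      then have "weyl_apply (wmult Q K) (Phi s) x = 0"
        using Phi_holomorphic[OF s(3)] s(1) by (simp add: weyl_apply_wmult)
      moreover have "weyl_apply (smult (lead_coeff K ^ m) T) (Phi s) x = 0"
        using T s by (simp add: weyl_apply_smult)
      ultimately show "weyl_apply R (Phi s) x = 0"
        by (simp add: QR(1) weyl_apply_add)
    qed (use \<open>R \<noteq> 0\<close> in \<open>auto intro: Phi_holomorphic\<close>)
    with QR(2) degree_K show False
      by simp
  qed
  with QR(1) show thesis
    using that[of "lead_coeff K ^ m" Q] K_nonzero by simp
qed

text \<open>The condition on p' says that every phi_ij is an honest eigenfunction of p(L0), so K
  p(L0) annihilates it. Conversely, a failure at some lam_i would give K one more independent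
  solution, up to a polynomial factor.\<close>

lemma Rset_K: "Rset K (L0 r a) = {p. \<forall>i<n. poly (pderiv p) (lam i) = 0}"
proof (intro equalityI subsetI CollectI allI impI)
  fix p assume p: "p \<in> {p. \<forall>i<n. poly (pderiv p) (lam i) = 0}"
  obtain s Q where sQ: "s \<noteq> 0" "smult s (wmult K (weval (L0 r a) p)) = wmult Q K"
  proof (rule annihilator_K)
    fix i j x assume ij: "i < n" "j < r"
    have "weyl_apply (weval (L0 r a) p) (Phi (i, j, False)) = (\<lambda>x. poly p (lam i) * Phi (i, j, False) x)"
      using p ij by (auto simp: weval_Phi)
    then show "weyl_apply (wmult K (weval (L0 r a) p)) (Phi (i, j, False)) x = 0"
      using ij by (simp add: weyl_apply_wmult weyl_apply_cmult Phi_holomorphic K_Phi)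
  qed
  have "embed (wmult K (weval (L0 r a) p)) = smult (Fract 1 s * Fract s 1) (embed (wmult K (weval (L0 r a) p)))"
    unfolding Fract_inverse(1)[OF sQ(1)] by simp
  also have "\<dots> = Dmult (smult (Fract 1 s) (embed Q)) (embed K)"
    using sQ(2) by (simp add: R.dmult_smult_left flip: embed_wmult smult_smult embed_smult del: mult_fract)
  finally show "p \<in> Rset K (L0 r a)"
    by (auto simp: Rset_def)
next
  fix p i assume p: "p \<in> Rset K (L0 r a)" and i: "i < n"
  obtain Q where Q: "embed (wmult K (weval (L0 r a) p)) = Dmult Q (embed K)"
    using p by (auto simp: Rset_def)
  obtain s W where s: "s \<noteq> 0" "smult (Fract s 1) Q = embed W"
    by (rule clear_denominators)
  have "embed (smult s (wmult K (weval (L0 r a) p))) = embed (wmult W K)"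
    by (simp add: embed_smult Q embed_wmult[of W] R.dmult_smult_left flip: s(2))
  then have sW: "smult s (wmult K (weval (L0 r a) p)) = wmult W K"
    by simp
  show "poly (pderiv p) (lam i) = 0"
  proof (rule ccontr)
    assume np: "poly (pderiv p) (lam i) \<noteq> 0"
    \<comment> \<open>One function beyond the phi_ij already exceeds the order N; index 0 is
      available because r is positive.\<close>
    let ?S = "insert (i, 0, True) ({..<n} \<times> {..<r} \<times> {False})"
    \<comment> \<open>Clearing the denominators of \<open>Q\<close> introduces \<open>s\<close>, and
      at zeros of \<open>s\<close> this identity says nothing about K itself. The operator
      \<open>smult s K\<close> has the same order and vanishes on the function everywhere.\<close>
    have KT: "poly s x * weyl_apply K (Phi (i, j, True)) x = 0" if j: "j < r" for j x
    proof -
      have hol: "Phi (i, j, b) holomorphic_on UNIV" for b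
        by (rule Phi_holomorphic[OF j])
      have "weyl_apply (weval (L0 r a) p) (Phi (i, j, False))
          = (\<lambda>x. poly p (lam i) * Phi (i, j, False) x + poly (pderiv p) (lam i) * Phi (i, j, True) x)"
        using j by (auto simp: weval_Phi)
      then have "weyl_apply (wmult K (weval (L0 r a) p)) (Phi (i, j, False)) x
          = poly (pderiv p) (lam i) * weyl_apply K (Phi (i, j, True)) x"
        by (simp add: weyl_apply_wmult[OF hol] weyl_apply_plus[OF hol hol] K_Phi[OF i j])
      moreover have "weyl_apply K (Phi (i, j, False)) = (\<lambda>_. 0)"
        using K_Phi[OF i j] by auto
      then have "weyl_apply (wmult W K) (Phi (i, j, False)) x = 0"
        by (simp add: weyl_apply_wmult[OF hol])
      ultimately show ?thesis
        using np by (simp add: weyl_apply_smult flip: sW)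
    qed
    have "card ?S \<le> degree (smult s K)"
    proof (rule card_indep_annihilated_le)
      show "indep_funs ?S Phi"
        using i r_pos by (intro indep_funs_mono[OF Phi_indep]) auto
      show "smult s K \<noteq> 0"
        using s(1) K_nonzero by simp
      show "weyl_apply (smult s K) (Phi t) x = 0" if "t \<in> ?S" for t x
        using that KT[OF r_pos, of x] by (auto simp: weyl_apply_smult K_Phi)
    qed (use r_pos in \<open>auto intro: Phi_holomorphic\<close>)
    with s(1) degree_K show False
      by simp
  qed
qed

text \<open>Vanishing of P' at the points puts P into R_{K,L0}; vanishing of P as well makes P(L0)
  itself annihilate all phi_ij, so that K becomes a right factor of P(L0).\<close>

lemma double_zeros_poly:
  "\<exists>P. degree P > 0 \<and> (\<forall>i<n. poly P (lam i) = 0 \<and> poly (pderiv P) (lam i) = 0)"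
proof (intro exI conjI allI impI)
  let ?P = "\<Prod>k<n. [:- lam k, 1:]\<^sup>2"
  have d: "[:- lam i, 1:]\<^sup>2 dvd ?P" if "i < n" for i
    using that by (intro dvd_prodI) auto
  show z: "poly ?P (lam i) = 0" "poly (pderiv ?P) (lam i) = 0" if "i < n" for i
    by (rule poly_double_root[OF d[OF that]])+
  show "degree ?P > 0"
  proof (rule ccontr)
    assume "\<not> degree ?P > 0"
    then obtain c where c: "?P = [:c:]"
      by (auto elim: degree_eq_zeroE)
    then have "c = 0"
      using z(1)[of 0] n by simp
    moreover have "?P \<noteq> 0"
      by simp
    ultimately show False
      using c by simp
  qed
qed

text \<open>If \<open>s P(L\<^sub>0) = Q K\<close>, then \<open>P(L\<^sub>0) = (s\<^sup>-\<^sup>1 Q \<theta>) \<theta>\<^sup>-\<^sup>1 K\<close> where \<open>\<theta>\<close> is a power of \<open>s\<close>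
  such that \<open>Q' = s\<^sup>-\<^sup>1 Q \<theta>\<close> has polynomial coefficients. In the skew field of fractions of the Weyl algebra
  \<open>\<flat>\<close> gives \<open>P(x) = K\<^sup>\<flat> \<theta>(L\<^sub>0)\<^sup>-\<^sup>1 Q'\<^sup>\<flat>\<close>, that is \<open>\<theta>(L\<^sub>0) = Q'\<^sup>\<flat> P(x)\<^sup>-\<^sup>1 K\<^sup>\<flat>\<close>, so
  \<open>\<theta>\<close> belongs to \<open>R\<close> of \<open>K\<^sup>\<flat>\<close>. The Ore multiples \<open>X\<close>, \<open>Y\<close> with \<open>K X = \<theta> Y\<close> replace the skew field.\<close>

lemma Rset_wflat_K_nonconstant: "\<exists>p\<in>Rset (wflat r a K) (L0 r a). degree p > 0"
proof -
  let ?L = "L0 r a" and ?F = "wflat r a"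
  obtain P where "degree P > 0 \<and> (\<forall>i<n. poly P (lam i) = 0 \<and> poly (pderiv P) (lam i) = 0)"
    using double_zeros_poly by (rule exE)
  then have P: "degree P > 0" "\<And>i. i < n \<Longrightarrow> poly P (lam i) = 0"
      "\<And>i. i < n \<Longrightarrow> poly (pderiv P) (lam i) = 0"
    by simp_all
  from P(1) have P0: "P \<noteq> 0" by auto
  have "weyl_apply (weval ?L P) (Phi (i, j, False)) x = 0" if "i < n" "j < r" for i j x
    using that by (simp add: weval_Phi P)
  then obtain s Q where s: "s \<noteq> 0" and sQ: "smult s (weval ?L P) = wmult Q K"
    by (rule annihilator_K)
  define \<theta> where "\<theta> = s ^ Suc (degree Q)"
  have \<theta>: "\<theta> \<noteq> 0" using s by (simp add: \<theta>_def)
  obtain Q' where Q': "wmult Q [:\<theta>:] = smult s Q'"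
    unfolding \<theta>_def by (rule wmult_power_const)
  define X where "X = [:\<theta> ^ Suc (degree K):]"
  obtain Y where Y: "wmult K X = smult \<theta> Y"
    unfolding X_def by (rule wmult_power_const)
  have "X \<noteq> 0"
    using \<theta> by (simp add: X_def)
  then have "Y \<noteq> 0"
    using W.dmult_nonzero[OF K_nonzero \<open>X \<noteq> 0\<close>] Y by auto
  have "smult s (wmult (weval ?L P) X) = wmult Q (wmult K X)"
    by (simp add: sQ W.dmult_assoc flip: W.dmult_smult_left)
  also have "\<dots> = wmult (wmult Q [:\<theta>:]) Y"
    by (simp add: Y W.dmult_assoc W.dmult_const_left)
  also have "\<dots> = smult s (wmult Q' Y)"
    by (simp add: Q' W.dmult_smult_left)
  finally have "smult s (wmult (weval ?L P) X - wmult Q' Y) = 0"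
    by (simp add: smult_diff_right)
  then have "wmult (weval ?L P) X = wmult Q' Y"
    using s by simp
  then have "?F (wmult (weval ?L P) X) = ?F (wmult Q' Y)"
    by simp
  then have e1: "wmult (?F X) [:P:] = wmult (?F Y) (?F Q')"
    by (simp add: wflat_wmult wflat_weval)
  have "?F (wmult K X) = ?F (smult \<theta> Y)"
    by (simp add: Y)
  then have e2: "wmult (?F X) (?F K) = wmult (?F Y) (weval ?L \<theta>)"
    by (simp add: wflat_wmult wflat_smult)
  \<comment> \<open>The left cofactor Q'^flat P(x)^-1 of K^flat in theta(L0). It is verified after
    multiplication by Y^flat, where \<open>e1\<close> and \<open>e2\<close> apply, and Y^flat is
    then cancelled.\<close>
  define Z where "Z = Dmult (embed (?F Q')) [:Fract 1 P:]"
  have "Dmult (embed (?F Y)) (Dmult Z (embed (?F K)))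
      = Dmult (embed (wmult (?F Y) (?F Q'))) (Dmult [:Fract 1 P:] (embed (?F K)))"
    by (simp add: Z_def embed_wmult R.dmult_assoc)
  also have "\<dots> = Dmult (embed (?F X)) (Dmult (Dmult [:Fract P 1:] [:Fract 1 P:]) (embed (?F K)))"
    by (simp only: e1[symmetric] embed_wmult embed_const R.dmult_assoc)
  also have "Dmult [:Fract P 1:] [:Fract 1 P:] = 1"
    using P0 by (simp add: R.dmult_const_const Fract_inverse del: mult_fract flip: one_pCons)
  also have "Dmult (embed (?F X)) (Dmult 1 (embed (?F K))) = Dmult (embed (?F Y)) (embed (weval ?L \<theta>))"
    by (simp add: e2 flip: embed_wmult)
  finally have Z: "Dmult Z (embed (?F K)) = embed (weval ?L \<theta>)"
    using R.dmult_cancel_left[of "embed (?F Y)"] \<open>Y \<noteq> 0\<close> by (simp add: wflat_eq_0_iff)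
  \<comment> \<open>The polynomial \<open>\<theta>\<close> may be constant, so z theta(z) is taken
    instead: K^flat L0 theta(L0) = (K^flat L0 Z) K^flat.\<close>
  have "embed (wmult (?F K) (weval ?L ([:0, 1:] * \<theta>)))
      = Dmult (Dmult (Dmult (embed (?F K)) (embed ?L)) Z) (embed (?F K))"
    by (simp only: weval_mult weval_X embed_wmult R.dmult_assoc Z)
  then have "[:0, 1:] * \<theta> \<in> Rset (?F K) ?L"
    by (auto simp: Rset_def)
  moreover have "degree ([:0, 1:] * \<theta>) > 0"
    using \<theta> by (subst degree_mult_eq) auto
  ultimately show ?thesis by blast
qed

text \<open>Each candidate satisfies the equation that determines \<open>conjD\<close> uniquely, so
  conjugation respects sums and products. Commutativity of the operators is then inherited from the
  polynomials.\<close>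

lemma conjD_ring:
  fixes C defines "C \<equiv> \<lambda>p. conjD (nrm K) (embed (weval (L0 r a) p))"
  assumes p: "p \<in> Rset K (L0 r a)" and q: "q \<in> Rset K (L0 r a)"
  shows "p + q \<in> Rset K (L0 r a)" "C p + C q = C (p + q)"
    and "- p \<in> Rset K (L0 r a)" "- C p = C (- p)"
    and "p * q \<in> Rset K (L0 r a)" "Dmult (C p) (C q) = C (p * q)"
proof -
  note nz = nrm_nonzero[OF K_nonzero]
  have Cd: "C t = conjD (nrm K) (embed (weval (L0 r a) t))" for t
    by (simp add: C_def)
  have Cp: "Dmult (C p) (nrm K) = Dmult (nrm K) (embed (weval (L0 r a) p))"
    and Cq: "Dmult (C q) (nrm K) = Dmult (nrm K) (embed (weval (L0 r a) q))"
    unfolding Cd by (rule conjD_nrm[OF K_nonzero p], rule conjD_nrm[OF K_nonzero q])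
  show "p + q \<in> Rset K (L0 r a)" "- p \<in> Rset K (L0 r a)" "p * q \<in> Rset K (L0 r a)"
    using p q by (simp_all add: Rset_K pderiv_add pderiv_minus pderiv_mult)
  show "C p + C q = C (p + q)"
    unfolding Cd[of "p + q"]
    by (rule conjD_eqI[OF nz, symmetric])
       (simp add: R.dmult_add_left R.dmult_add_right Cp Cq weval_add embed_add)
  show "- C p = C (- p)"
    unfolding Cd[of "- p"]
    by (rule conjD_eqI[OF nz, symmetric])
       (simp add: R.dmult_minus_left R.dmult_minus_right Cp weval_uminus embed_uminus)
  have "Dmult (Dmult (C p) (C q)) (nrm K) = Dmult (Dmult (C p) (nrm K)) (embed (weval (L0 r a) q))"
    by (simp add: R.dmult_assoc Cq)
  also have "\<dots> = Dmult (nrm K) (embed (weval (L0 r a) (p * q)))"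
    by (simp only: Cp R.dmult_assoc weval_mult embed_wmult)
  finally show "Dmult (C p) (C q) = C (p * q)"
    unfolding Cd[of "p * q"] by (rule conjD_eqI[OF nz, symmetric])
qed

lemma conjD_const:
  "conjD (nrm K) (embed (weval (L0 r a) 1)) = 1" "conjD (nrm K) (embed (weval (L0 r a) 0)) = 0"
  by (rule conjD_eqI[OF nrm_nonzero[OF K_nonzero]]; simp)+

end

theorem mainTheorem2:
  fixes r n :: nat and a :: "nat \<Rightarrow> complex" and f :: "nat \<Rightarrow> complex \<Rightarrow> complex"
    and lam gam :: "nat \<Rightarrow> complex"
  assumes r: "r > 1"
    and f_ker: "\<And>j. j < r \<Longrightarrow> in_ker (L0 r a) (f j)"
    and f_span: "\<And>g. in_ker (L0 r a) g \<Longrightarrow> \<exists>c. g = (\<lambda>x. \<Sum>j<r. c j * f j x)"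
    and f_wr: "\<And>x. wr_det (map f [0..<r]) x = 1"
    and n: "n \<ge> 1"
    and lam: "inj_on lam {..<n}"
  defines "K \<equiv> Kbar r f n lam gam"
    and "tau \<equiv> lead_coeff (Kbar r f n lam gam)"
    and "aflat \<equiv> lead_coeff (wflat r a (Kbar r f n lam gam))"
    and "KC \<equiv> smult (Fract 1 (lead_coeff (Kbar r f n lam gam))) (embed (Kbar r f n lam gam))"
    and "Kt \<equiv> smult (Fract 1 (lead_coeff (wflat r a (Kbar r f n lam gam))))
                 (embed (wflat r a (Kbar r f n lam gam)))"
  shows
    "(\<exists>p\<in>Rset K (L0 r a). degree p > 0)
     \<and> (\<exists>p\<in>Rset (wflat r a K) (L0 r a). degree p > 0)
     \<and> Rset K (L0 r a) = {p. \<forall>i<n. poly (pderiv p) (lam i) = 0}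
     \<and> (let RC = (\<lambda>p. conjD KC (embed (weval (L0 r a) p))) ` Rset K (L0 r a) in
          1 \<in> RC \<and> 0 \<in> RC
          \<and> (\<forall>A\<in>RC. \<forall>B\<in>RC. A + B \<in> RC \<and> - A \<in> RC \<and> Dmult A B \<in> RC
                              \<and> Dmult A B = Dmult B A))
     \<and> (\<forall>fz. in_ker (L0 r a) fz \<and> fz \<noteq> (\<lambda>_. 0) \<longrightarrow>
          (let phi = (\<lambda>x z. weyl_apply K (\<lambda>y. fz (y + z)) x / (poly tau x * poly aflat z)) in
            (\<forall>p\<in>Rset K (L0 r a). \<forall>x z.
               poly tau x \<noteq> 0 \<and> poly aflat z \<noteq> 0
               \<and> D_defined_at (conjD KC (embed (weval (L0 r a) p))) x \<longrightarrow>
               D_apply (conjD KC (embed (weval (L0 r a) p))) (\<lambda>y. phi y z) x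
                 = poly p z * phi x z)
          \<and> (\<forall>p\<in>Rset (wflat r a K) (L0 r a).
               (\<exists>P. Dmult P Kt = Dmult Kt (embed (weval (L0 r a) p)))
               \<and> (\<forall>x z. poly tau x \<noteq> 0 \<and> poly aflat z \<noteq> 0
                   \<and> D_defined_at (conjD Kt (embed (weval (L0 r a) p))) z \<longrightarrow>
                   D_apply (conjD Kt (embed (weval (L0 r a) p))) (\<lambda>w. phi x w) z
                     = poly p x * phi x z))))"
proof -
  interpret airy r n a f lam gam
    using r f_ker f_wr n lam by unfold_locales
  let ?F = "wflat r a (Kbar r f n lam gam)"
  have K0: "K \<noteq> 0" and F0: "?F \<noteq> 0"
    using K_nonzero by (simp_all add: K_def wflat_eq_0_iff)
  have KC: "KC = nrm K" and Kt: "Kt = nrm ?F" and FK: "wflat r a K = ?F"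
    by (simp_all add: KC_def Kt_def nrm_def K_def)
  have "(\<exists>p\<in>Rset K (L0 r a). degree p > 0)"
    using double_zeros_poly by (auto simp: K_def Rset_K)
  moreover have "(\<exists>p\<in>Rset (wflat r a K) (L0 r a). degree p > 0)"
    unfolding FK by (rule Rset_wflat_K_nonconstant)
  moreover have "Rset K (L0 r a) = {p. \<forall>i<n. poly (pderiv p) (lam i) = 0}"
    unfolding K_def by (rule Rset_K)
  moreover have "let RC = (\<lambda>p. conjD KC (embed (weval (L0 r a) p))) ` Rset K (L0 r a) in
          1 \<in> RC \<and> 0 \<in> RC
          \<and> (\<forall>A\<in>RC. \<forall>B\<in>RC. A + B \<in> RC \<and> - A \<in> RC \<and> Dmult A B \<in> RC
                              \<and> Dmult A B = Dmult B A)"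
  proof -
    let ?C = "\<lambda>p. conjD (nrm K) (embed (weval (L0 r a) p))"
    have "1 \<in> Rset K (L0 r a)" "0 \<in> Rset K (L0 r a)"
      by (simp_all add: K_def Rset_K)
    then have "1 \<in> ?C ` Rset K (L0 r a)" "0 \<in> ?C ` Rset K (L0 r a)"
      unfolding K_def by (metis imageI conjD_const(1), metis imageI conjD_const(2))
    moreover have "?C p + ?C q \<in> ?C ` Rset K (L0 r a)" "- ?C p \<in> ?C ` Rset K (L0 r a)"
        "Dmult (?C p) (?C q) \<in> ?C ` Rset K (L0 r a)" "Dmult (?C p) (?C q) = Dmult (?C q) (?C p)"
      if "p \<in> Rset K (L0 r a)" "q \<in> Rset K (L0 r a)" for p q
      using conjD_ring[OF that[unfolded K_def]] conjD_ring(6)[OF that(2,1)[unfolded K_def]]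
      by (simp_all add: K_def mult.commute)
    ultimately show ?thesis
      unfolding KC Let_def by blast
  qed
  moreover have "let phi = (\<lambda>x z. weyl_apply K (\<lambda>y. fz (y + z)) x / (poly tau x * poly aflat z)) in
            (\<forall>p\<in>Rset K (L0 r a). \<forall>x z.
               poly tau x \<noteq> 0 \<and> poly aflat z \<noteq> 0
               \<and> D_defined_at (conjD KC (embed (weval (L0 r a) p))) x \<longrightarrow>
               D_apply (conjD KC (embed (weval (L0 r a) p))) (\<lambda>y. phi y z) x
                 = poly p z * phi x z)
          \<and> (\<forall>p\<in>Rset (wflat r a K) (L0 r a).
               (\<exists>P. Dmult P Kt = Dmult Kt (embed (weval (L0 r a) p)))
               \<and> (\<forall>x z. poly tau x \<noteq> 0 \<and> poly aflat z \<noteq> 0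
                   \<and> D_defined_at (conjD Kt (embed (weval (L0 r a) p))) z \<longrightarrow>
                   D_apply (conjD Kt (embed (weval (L0 r a) p))) (\<lambda>w. phi x w) z
                     = poly p x * phi x z))"
    if fz: "in_ker (L0 r a) fz" for fz
  proof -
    have hol: "(\<lambda>y. fz (y + z)) holomorphic_on UNIV" for z
      by (rule holomorphic_shift[OF in_kerD(1)[OF fz]])
    have eig: "weyl_apply (L0 r a) (\<lambda>y. fz (y + z)) x = z * fz (x + z)" for x z
      using in_kerD(2)[OF fz] by (simp add: weyl_apply_L0_shift)
    \<comment> \<open>Exchange of the variables: as a function of \<open>z\<close>, the numerator of
      phi is K^flat applied to a translate of \<open>fz\<close> by \<open>x\<close>, an
      eigenfunction of L0 in \<open>z\<close> with eigenvalue \<open>x\<close>.\<close>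
    have flip: "weyl_apply K (\<lambda>y. fz (y + z)) x = weyl_apply ?F (\<lambda>w. fz (w + x)) z" for x z
      using weyl_apply_wflat[OF fz, of K z x] by (simp add: FK add.commute)
    have tau: "tau = lead_coeff K" and aflat: "aflat = lead_coeff ?F"
      by (simp_all add: tau_def aflat_def K_def)
    have 1: "D_apply (conjD KC (embed (weval (L0 r a) p)))
        (\<lambda>y. weyl_apply K (\<lambda>y. fz (y + z)) y / (poly tau y * poly aflat z)) x
        = poly p z * (weyl_apply K (\<lambda>y. fz (y + z)) x / (poly tau x * poly aflat z))"
      if "p \<in> Rset K (L0 r a)" "poly tau x \<noteq> 0" "D_defined_at (conjD KC (embed (weval (L0 r a) p))) x"
      for p x z
      unfolding KC tau
      by (rule conjD_eigenfunction[OF K0 that(1) hol eig that(2,3)[unfolded KC tau]])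
    have 2: "D_apply (conjD Kt (embed (weval (L0 r a) p)))
        (\<lambda>w. weyl_apply K (\<lambda>y. fz (y + w)) x / (poly tau x * poly aflat w)) z
        = poly p x * (weyl_apply K (\<lambda>y. fz (y + z)) x / (poly tau x * poly aflat z))"
      if "p \<in> Rset (wflat r a K) (L0 r a)" "poly aflat z \<noteq> 0"
        "D_defined_at (conjD Kt (embed (weval (L0 r a) p))) z"
      for p x z
      \<comment> \<open>The same eigenfunction lemma as for K, with the roles exchanged: tau(x) is
        now the constant factor, hence the reordering of the denominator.\<close>
      unfolding Kt aflat flip mult.commute[of "poly tau x"]
      by (rule conjD_eigenfunction[OF F0 that(1)[unfolded FK] hol eig that(2,3)[unfolded Kt aflat]])
    have 3: "\<exists>P. Dmult P Kt = Dmult Kt (embed (weval (L0 r a) p))"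
      if "p \<in> Rset (wflat r a K) (L0 r a)" for p
      unfolding Kt by (rule Rset_nrm[OF F0 that[unfolded FK]])
    show ?thesis
      unfolding Let_def using 1 2 3 by blast
  qed
  ultimately show ?thesis by blast
qed

end
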